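(* Let $\mu,\epsilon>0$ be constants, let $\Omega_\Gamma^h\subset\mathbb{R}^3$ be a local patch of side length $\ell_h>0$, let $I_\Gamma^h=[t_n-\Delta t_\Gamma,t_n]$ with $\Delta t_\Gamma>0$, and let $\Gamma$ be a time-independent embedded boundary with unit normal $\hat{\mathbf n}$. For $m=1,2,3,4$ let $\Gamma_{m,i}$, $i=1,\dots,N_m$, be fictitious interfaces in $\Omega_\Gamma^h$ with unit normals $\hat{\mathbf n}_{m,i}$, and put $N_E=N_1+N_3$, $N_H=N_2+N_4$. Let $\mathbf E^*,\mathbf H^*$ be given fields on the fictitious interfaces. Let $k\ge0$ be an integer, $$V=\big\{\mathbf v\in[P^k(\Omega_\Gamma^h\times I_\Gamma^h)]^3:\ \nabla\cdot\mathbf v=0\big\},\qquad W=V,$$ and, for $c_p>0$ and $c_f>0$, consider the problem of minimizing over $(\mathbf D_H,\mathbf D_E)\in V\times W$ the quadratic functional $$\begin{aligned} \tilde J(\mathbf D_H,\mathbf D_E)=\ &\tfrac{\ell_h}{2}\langle\mu\,\partial_t\mathbf D_H+\nabla\times\mathbf D_E,\ \mu\,\partial_t\mathbf D_H+\nabla\times\mathbf D_E\rangle\\ &+\tfrac{\ell_h}{2}\langle\epsilon\,\partial_t\mathbf D_E-\nabla\times\mathbf D_H,\ \epsilon\,\partial_t\mathbf D_E-\nabla\times\mathbf D_H\rangle\\ &+\tfrac{c_p}{2}\langle\hat{\mathbf n}\times\mathbf D_E,\hat{\mathbf n}\times\mathbf D_E\rangle_\Gamma+\tfrac{c_p}{2}\langle\hat{\mathbf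 n}\cdot\mathbf D_H,\hat{\mathbf n}\cdot\mathbf D_H\rangle_\Gamma\\ &+\tfrac{c_f}{2N_E}\sum_{i=1}^{N_1}\langle\hat{\mathbf n}_{1,i}\times(\mathbf D_E-\mathbf E^* ),\hat{\mathbf n}_{1,i}\times(\mathbf D_E-\mathbf E^* )\rangle_{\Gamma_{1,i}}\\ &+\tfrac{c_f}{2N_H}\sum_{i=1}^{N_2}\langle\hat{\mathbf n}_{2,i}\times(\mathbf D_H-\mathbf H^* ),\hat{\mathbf n}_{2,i}\times(\mathbf D_H-\mathbf H^* )\rangle_{\Gamma_{2,i}}\\ &+\tfrac{c_f}{2N_E}\sum_{i=1}^{N_3}\langle\hat{\mathbf n}_{3,i}\cdot(\mathbf D_E-\mathbf E^* ),\hat{\mathbf n}_{3,i}\cdot(\mathbf D_E-\mathbf E^* )\rangle_{\Gamma_{3,i}}\\ &+\tfrac{c_f}{2N_H}\sum_{i=1}^{N_4}\langle\hat{\mathbf n}_{4,i}\cdot(\mathbf D_H-\mathbf H^* ),\hat{\mathbf n}_{4,i}\cdot(\mathbf D_H-\mathbf H^* )\rangle_{\Gamma_{4,i}} . \end{aligned}$$ Assume that for each type $m\in\{1,2,3,4\}$ and for each of the three coordinate planes of the Cartesian coordinate system, there are, among the fictitious interfaces $\Gamma_{m,1},\dots,\Gamma_{m,N_m}$, interfaces collinear with (parallel to) that plane and interfaces orthogonal to that plane. Then there exists a positive constant $\tilde c=\frac{c_f}{\ell_h}$ (that is, a choice of $c_f>0$ for the given $\ell_h$ and $c_p$) for which $\tilde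 J$ has a unique global minimizer in $V\times W$.
   Context: The local patch $\Omega_\Gamma^h$ is an axis-aligned cube of side $\ell_h$ centred at a point of the embedded boundary $\Gamma$, which separates a subdomain $\Omega^-$ (perfect electric conductor) from $\Omega^+$. A fictitious interface is a planar piece of surface of positive area, $\Gamma_{m,i}\subset\Omega^+\cap\Omega_\Gamma^h$; the type $m$ records which condition is imposed on it: $m=1$: $\hat{\mathbf n}_{1,i}\times(\mathbf E^+-\mathbf E^* )=0$; $m=2$: $\hat{\mathbf n}_{2,i}\times(\mathbf H^+-\mathbf H^* )=0$; $m=3$: $\hat{\mathbf n}_{3,i}\cdot(\mathbf E^+-\mathbf E^* )=0$; $m=4$: $\hat{\mathbf n}_{4,i}\cdot(\mathbf H^+-\mathbf H^* )=0$, where $\mathbf E^+,\mathbf H^+$ are the fields in $\Omega^+$ and $\mathbf E^*,\mathbf H^*$ are given (square-integrable) approximations of them. The inner products are $$\langle\mathbf v,\mathbf w\rangle=\int_{I_\Gamma^h}\int_{\Omega_\Gamma^h}\mathbf v\cdot\mathbf w\,dV\,dt,\qquad \langle\mathbf v,\mathbf w\rangle_{S}=\int_{I_\Gamma^h}\int_{\Omega_\Gamma^h\cap S}\mathbf v\cdot\mathbf w\,dS\,dt\quad\text{for } S=\Gamma \text{ or } S=\Gamma_{m,i},$$ with the ordinary product of scalars used for scalar-valued entries. $P^k(\Omega_\Gamma^h\times I_\Gamma^h)$ denotes the polynomials of degree at most $k$ in the space-time variables $(\mathbf x,t)$; $\nabla\cdot$ and $\nabla\times$ act on the space variables only. *)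

theory Defs
  imports "HOL-Analysis.Analysis"
begin

unbundle no cross3_syntax

subsection \<open>Surface measure\<close>

text \<open>Two-dimensional Hausdorff measure on three-space. The factor \<open>pi / 4\<close> (area of the
  disc of diameter 1) makes it agree with the usual area on \<open>C^1\<close> surfaces.\<close>

definition hausdorff2_premeasure :: "real \<Rightarrow> (real^3) set \<Rightarrow> ennreal" where
  "hausdorff2_premeasure \<delta> A =
     (INF C \<in> {C :: nat \<Rightarrow> (real^3) set.
                 A \<subseteq> (\<Union>i. C i) \<and> (\<forall>i. bounded (C i) \<and> diameter (C i) \<le> \<delta>)}.
        (\<Sum>i. ennreal (pi / 4 * (diameter (C i))\<^sup>2)))"

definition hausdorff2 :: "(real^3) set \<Rightarrow> ennreal" where
  "hausdorff2 A = (SUP \<delta>\<in>{0<..}. hausdorff2_premeasure \<delta> A)"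

definition surface_measure :: "(real^3) measure" where
  "surface_measure = measure_of UNIV (sets borel) hausdorff2"


subsection \<open>Space-time fields and differential operators\<close>

text \<open>A field takes a pair \<open>(x, t)\<close> of a point in space and a time. The \<open>(i, j)\<close> entry of the
  spatial Jacobian is the \<open>j\<close>-th partial derivative of the \<open>i\<close>-th component.\<close>

type_synonym vfield = "(real^3) \<times> real \<Rightarrow> real^3"

definition time_deriv :: "vfield \<Rightarrow> vfield" where
  "time_deriv F = (\<lambda>(x, t). vector_derivative (\<lambda>s. F (x, s)) (at t))"

definition divergence :: "vfield \<Rightarrow> (real^3) \<times> real \<Rightarrow> real" where
  "divergence F = (\<lambda>(x, t). trace (jacobian (\<lambda>y. F (y, t)) (at x)))"

definition curl :: "vfield \<Rightarrow> vfield" where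
  "curl F = (\<lambda>(x, t). let J = jacobian (\<lambda>y. F (y, t)) (at x) in
     vector [J$3$2 - J$2$3, J$1$3 - J$3$1, J$2$1 - J$1$2])"


subsection \<open>Polynomial spaces\<close>

definition poly_space :: "nat \<Rightarrow> ((real^3) \<times> real \<Rightarrow> real) set" where
  "poly_space k = {p. \<exists>c :: nat^3 \<Rightarrow> nat \<Rightarrow> real. \<forall>x t. p (x, t) =
     (\<Sum>(\<alpha>, m) \<in> {(\<alpha>, m). (\<Sum>j\<in>UNIV. \<alpha>$j) + m \<le> k}. c \<alpha> m * (\<Prod>j\<in>UNIV. (x$j) ^ (\<alpha>$j)) * t ^ m)}"

text \<open>Polynomials on \<open>\<Omega> \<times> I\<close> are represented by polynomial functions on all of space-time. This
  is faithful when \<open>\<Omega>\<close> is a nondegenerate cube and \<open>I\<close> a nondegenerate interval, since a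
  polynomial is then determined by its values on \<open>\<Omega> \<times> I\<close>.\<close>

definition div_free_poly :: "nat \<Rightarrow> (real^3) set \<Rightarrow> real set \<Rightarrow> vfield set" where
  "div_free_poly k \<Omega> I =
     {v. (\<forall>j. (\<lambda>z. v z $ j) \<in> poly_space k) \<and> (\<forall>z\<in>\<Omega> \<times> I. divergence v z = 0)}"


subsection \<open>Geometry\<close>

definition local_patch :: "real^3 \<Rightarrow> real \<Rightarrow> (real^3) set" where
  "local_patch p l = cbox (p - vec (l / 2)) (p + vec (l / 2))"

text \<open>\<open>\<nu>\<close> is orthogonal to every limit of secant directions of \<open>S\<close> at \<open>x\<close>; for a \<open>C^1\<close> surface
  this says that \<open>\<nu>\<close> is orthogonal to the tangent plane at \<open>x\<close>.\<close>

definition normal_at :: "(real^3) set \<Rightarrow> real^3 \<Rightarrow> real^3 \<Rightarrow> bool" where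
  "normal_at S x \<nu> \<longleftrightarrow> ((\<lambda>y. ((y - x) \<bullet> \<nu>) / norm (y - x)) \<longlongrightarrow> 0) (at x within S)"

text \<open>Asking for the unit normal only almost everywhere (with respect to area) admits boundaries
  with edges and corners besides smooth ones. Measurability of the normal and local finiteness of
  the area are what the surface integrals over \<open>\<Gamma>\<close> need to make sense.\<close>

definition embedded_boundary ::
  "(real^3) set \<Rightarrow> (real^3) set \<Rightarrow> (real^3) set \<Rightarrow> (real^3 \<Rightarrow> real^3) \<Rightarrow> bool" where
  "embedded_boundary \<Omega>m \<Omega>p \<Gamma> n \<longleftrightarrow>
     open \<Omega>m \<and> open \<Omega>p \<and> \<Omega>m \<inter> \<Omega>p = {} \<and> \<Gamma> = frontier \<Omega>m \<inter> frontier \<Omega>p \<and>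
     (\<forall>K. compact K \<longrightarrow> emeasure surface_measure (\<Gamma> \<inter> K) < \<infinity>) \<and>
     n \<in> borel_measurable (restrict_space borel \<Gamma>) \<and>
     (AE x in surface_measure. x \<in> \<Gamma> \<longrightarrow> norm (n x) = 1 \<and> normal_at \<Gamma> x (n x))"

definition fictitious_interface ::
  "(real^3) set \<Rightarrow> (real^3) set \<Rightarrow> (real^3) set \<Rightarrow> real^3 \<Rightarrow> bool" where
  "fictitious_interface \<Omega>p \<Omega> S \<nu> \<longleftrightarrow>
     S \<subseteq> \<Omega>p \<inter> \<Omega> \<and> S \<in> sets borel \<and> norm \<nu> = 1 \<and> (\<exists>d. \<forall>x\<in>S. \<nu> \<bullet> x = d) \<and>
     emeasure surface_measure S > 0"

text \<open>The coordinate plane number \<open>j\<close> is the one with normal \<open>axis j 1\<close>; \<open>\<nu>\<close> is the normal of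
  the planar piece that is compared with it.\<close>

definition parallel_to_coord_plane :: "real^3 \<Rightarrow> 3 \<Rightarrow> bool" where
  "parallel_to_coord_plane \<nu> j \<longleftrightarrow> (\<exists>r. \<nu> = r *\<^sub>R axis j 1)"

definition orthogonal_to_coord_plane :: "real^3 \<Rightarrow> 3 \<Rightarrow> bool" where
  "orthogonal_to_coord_plane \<nu> j \<longleftrightarrow> orthogonal \<nu> (axis j 1)"


subsection \<open>Inner products and the functional\<close>

definition square_integrable_field :: "(real^3) set \<Rightarrow> real set \<Rightarrow> vfield \<Rightarrow> bool" where
  "square_integrable_field S I F \<longleftrightarrow>
     (let M = restrict_space surface_measure S \<Otimes>\<^sub>M restrict_space lborel I in
        F \<in> borel_measurable M \<and> integrable M (\<lambda>z. (norm (F z))\<^sup>2))"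

definition st_inner :: "(real^3) measure \<Rightarrow> (real^3) set \<Rightarrow> real set \<Rightarrow>
    ((real^3) \<times> real \<Rightarrow> 'b::real_inner) \<Rightarrow> ((real^3) \<times> real \<Rightarrow> 'b) \<Rightarrow> real" where
  "st_inner M A I v w = (LINT t:I|lborel. (LINT x:A|M. v (x, t) \<bullet> w (x, t)))"

definition patch_sq :: "(real^3) set \<Rightarrow> real set \<Rightarrow> ((real^3) \<times> real \<Rightarrow> 'b::real_inner) \<Rightarrow> real" where
  "patch_sq \<Omega> I v = st_inner lborel \<Omega> I v v"

definition surface_sq ::
  "(real^3) set \<Rightarrow> real set \<Rightarrow> (real^3) set \<Rightarrow> ((real^3) \<times> real \<Rightarrow> 'b::real_inner) \<Rightarrow> real" where
  "surface_sq \<Omega> I S v = st_inner surface_measure (\<Omega> \<inter> S) I v v"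

text \<open>The interfaces \<open>\<Gamma>f m i\<close> of type \<open>m\<close> with normals \<open>nf m i\<close> are numbered \<open>i = 1, ..., N m\<close>.\<close>

definition Jtilde ::
  "real \<Rightarrow> real \<Rightarrow> real \<Rightarrow> real \<Rightarrow> real \<Rightarrow> (real^3) set \<Rightarrow> real set \<Rightarrow>
   (real^3) set \<Rightarrow> (real^3 \<Rightarrow> real^3) \<Rightarrow>
   (nat \<Rightarrow> nat) \<Rightarrow> (nat \<Rightarrow> nat \<Rightarrow> (real^3) set) \<Rightarrow> (nat \<Rightarrow> nat \<Rightarrow> real^3) \<Rightarrow>
   vfield \<Rightarrow> vfield \<Rightarrow> vfield \<times> vfield \<Rightarrow> real" where
  "Jtilde \<mu> \<epsilon> l c\<^sub>p c\<^sub>f \<Omega> I \<Gamma> n N \<Gamma>f nf Es Hs = (\<lambda>(D\<^sub>H, D\<^sub>E).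
     l / 2 * patch_sq \<Omega> I (\<lambda>z. \<mu> *\<^sub>R time_deriv D\<^sub>H z + curl D\<^sub>E z)
   + l / 2 * patch_sq \<Omega> I (\<lambda>z. \<epsilon> *\<^sub>R time_deriv D\<^sub>E z - curl D\<^sub>H z)
   + c\<^sub>p / 2 * surface_sq \<Omega> I \<Gamma> (\<lambda>(x, t). cross3 (n x) (D\<^sub>E (x, t)))
   + c\<^sub>p / 2 * surface_sq \<Omega> I \<Gamma> (\<lambda>(x, t). n x \<bullet> D\<^sub>H (x, t))
   + c\<^sub>f / (2 * real (N 1 + N 3)) *
       (\<Sum>i=1..N 1. surface_sq \<Omega> I (\<Gamma>f 1 i) (\<lambda>z. cross3 (nf 1 i) (D\<^sub>E z - Es z)))
   + c\<^sub>f / (2 * real (N 2 + N 4)) *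
       (\<Sum>i=1..N 2. surface_sq \<Omega> I (\<Gamma>f 2 i) (\<lambda>z. cross3 (nf 2 i) (D\<^sub>H z - Hs z)))
   + c\<^sub>f / (2 * real (N 1 + N 3)) *
       (\<Sum>i=1..N 3. surface_sq \<Omega> I (\<Gamma>f 3 i) (\<lambda>z. nf 3 i \<bullet> (D\<^sub>E z - Es z)))
   + c\<^sub>f / (2 * real (N 2 + N 4)) *
       (\<Sum>i=1..N 4. surface_sq \<Omega> I (\<Gamma>f 4 i) (\<lambda>z. nf 4 i \<bullet> (D\<^sub>H z - Hs z))))"

end

theory Submission
  imports Defs "HOL-Library.Function_Algebras"
begin

text \<open>A quadratic functional on a finite-dimensional space has a unique minimizer as soon as its
  homogeneous part is positive definite, so everything reduces to showing that fields annihilated by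
  all eight terms vanish. For such fields the volume terms and the divergence constraint form a
  first-order system with constant coefficients that can be solved for the \<open>x\<^sub>1\<close>-derivative of all six
  components, and the interfaces parallel to the plane \<open>x\<^sub>1 = 0\<close> make each component vanish on some
  plane \<open>x\<^sub>1 = s\<close>, where \<open>s\<close> depends on the component. The \<open>x\<^sub>2\<close>-, \<open>x\<^sub>3\<close>- and \<open>t\<close>-derivatives
  of a polynomial solution are solutions of the same problem of lower degree, hence zero by induction
  on the degree; then the \<open>x\<^sub>1\<close>-derivative is zero as well, so the fields are constant and therefore
  zero.

  A polynomial that vanishes almost everywhere on a planar piece of positive area vanishes on the
  whole plane, because the zero set of a nonzero polynomial in the plane is Lebesgue null and the
  two-dimensional Hausdorff measure of a Lipschitz image is bounded by a multiple of the planar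
  Lebesgue measure.\<close>

subsection \<open>Polynomial functions of bounded degree\<close>

text \<open>The obstacle is that the zeros are not given on a single hyperplane: a tangential
  condition annihilates components 2 and 3 on one plane, a normal condition annihilates component 1
  on another, and the planes for \<open>E\<close> and \<open>H\<close> may differ too.
  Differentiation in a direction tangential to all these parallel planes keeps every zero in place,
  whichever plane it lies on, and it commutes with a system with constant coefficients; hence the
  induction on the degree. The divergence constraint supplies the x_1-derivatives of the first
  components, which the curl equations do not contain. Patch and time interval serve to identify
  polynomials: every vanishing statement is extended to all times and to whole planes or all of
  space, so the system is studied without any boundary. The minimizer comes from completing the
  square, with a linear form represented by the quadratic form. The choice of the interface weight
  only has to make it positive, so the patch side \<open>l\<close> is taken, which makes the ratio
  1.\<close>

text \<open>Coordinate-free and vector-valued, so that restrictions to lines, planes and time slices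
  and passage to components stay inside the notion without handling monomials. Since
  \<open>const\<close> is available for every \<open>k\<close>, the index is an upper bound for the
  degree.\<close>

inductive poly_fun :: "nat \<Rightarrow> ('a::real_inner \<Rightarrow> 'b::real_normed_vector) \<Rightarrow> bool" where
  const: "poly_fun k (\<lambda>z. c)"
| mult: "poly_fun k f \<Longrightarrow> poly_fun (Suc k) (\<lambda>z. (z \<bullet> b) *\<^sub>R f z)"
| add: "poly_fun k f \<Longrightarrow> poly_fun k g \<Longrightarrow> poly_fun k (\<lambda>z. f z + g z)"

lemma poly_fun_Suc: "poly_fun k f \<Longrightarrow> poly_fun (Suc k) f"
  by (induction rule: poly_fun.induct) (auto intro: poly_fun.intros)

lemma poly_fun_mono: "poly_fun k f \<Longrightarrow> k \<le> m \<Longrightarrow> poly_fun m f"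
  by (induction m) (auto simp: le_Suc_eq intro: poly_fun_Suc)

lemma poly_fun_linear:
  assumes "linear L" "poly_fun k f"
  shows "poly_fun k (\<lambda>z. L (f z))"
  using assms(2)
  by (induction rule: poly_fun.induct)
     (auto simp: linear_add[OF assms(1)] linear_scale[OF assms(1)] intro: poly_fun.intros)

lemma poly_fun_sum:
  "(\<And>i. i \<in> A \<Longrightarrow> poly_fun k (f i)) \<Longrightarrow> poly_fun k (\<lambda>z. \<Sum>i\<in>A. f i z)"
  by (induction A rule: infinite_finite_induct) (auto intro: poly_fun.intros)

lemma poly_fun_scaleR_mult:
  fixes f :: "'a::real_inner \<Rightarrow> real" and g :: "'a \<Rightarrow> 'b::real_normed_vector"
  assumes "poly_fun k f" "poly_fun m g"
  shows "poly_fun (k + m) (\<lambda>z. f z *\<^sub>R g z)"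
  using assms(1)
proof (induction rule: poly_fun.induct)
  case (const k c)
  have "poly_fun m (\<lambda>z. c *\<^sub>R g z)"
    by (rule poly_fun_linear[OF _ assms(2)]) (auto intro: linearI simp: scaleR_add_right)
  then show ?case by (rule poly_fun_mono) simp
next
  case (mult k f b)
  then show ?case using poly_fun.mult[OF mult.IH, of b] by simp
next
  case (add k f h)
  then show ?case using poly_fun.add[OF add.IH] by (simp add: scaleR_add_left)
qed

lemma poly_fun_mult:
  fixes f g :: "'a::real_inner \<Rightarrow> real"
  assumes "poly_fun k f" "poly_fun m g"
  shows "poly_fun (k + m) (\<lambda>z. f z * g z)"
  using poly_fun_scaleR_mult[OF assms] by simp

lemma poly_fun_power:
  fixes f :: "'a::real_inner \<Rightarrow> real"
  assumes "poly_fun 1 f"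
  shows "poly_fun m (\<lambda>z. f z ^ m)"
proof (induction m)
  case 0
  then show ?case by (auto intro: poly_fun.intros)
next
  case (Suc m)
  then show ?case using poly_fun_mult[OF assms Suc] by simp
qed

lemma poly_fun_prod:
  fixes f :: "'i \<Rightarrow> 'a::real_inner \<Rightarrow> real"
  assumes "\<And>i. i \<in> A \<Longrightarrow> poly_fun (d i) (f i)"
  shows "poly_fun (\<Sum>i\<in>A. d i) (\<lambda>z. \<Prod>i\<in>A. f i z)"
  using assms
  by (induction A rule: infinite_finite_induct) (auto intro: poly_fun.intros poly_fun_mult)

lemma poly_fun_bounded_linear:
  fixes L :: "'a::euclidean_space \<Rightarrow> 'b::euclidean_space"
  assumes "linear L"
  shows "poly_fun 1 L"
proof -
  have "L = (\<lambda>z. \<Sum>b\<in>Basis. (z \<bullet> b) *\<^sub>R L b)"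
    by (rule ext)
       (metis (no_types, lifting) assms euclidean_representation linear_scale linear_sum sum.cong)
  moreover have "poly_fun 1 (\<lambda>z. (z \<bullet> b) *\<^sub>R L b)" for b
    using poly_fun.mult[OF poly_fun.const[of 0 "L b"], of b] by simp
  ultimately show ?thesis
    by (subst \<open>L = _\<close>) (rule poly_fun_sum)
qed

lemma poly_fun_compose_affine:
  fixes f :: "'a::euclidean_space \<Rightarrow> 'b::real_normed_vector"
    and L :: "'c::euclidean_space \<Rightarrow> 'a"
  assumes "linear L" "poly_fun k f"
  shows "poly_fun k (\<lambda>z. f (a + L z))"
  using assms(2)
proof (induction rule: poly_fun.induct)
  case (mult k f b)
  have "linear (\<lambda>z. L z \<bullet> b)"
    using assms(1) by (auto intro!: linearI simp: linear_add linear_scale inner_add_left)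
  from poly_fun.add[OF poly_fun.const[of 1 "a \<bullet> b"] poly_fun_bounded_linear[OF this]]
  have "poly_fun 1 (\<lambda>z. (a + L z) \<bullet> b)" by (simp add: inner_add_left)
  from poly_fun_scaleR_mult[OF this mult.IH] show ?case by simp
qed (auto intro: poly_fun.intros)

lemma poly_fun_real_poly:
  fixes f :: "real \<Rightarrow> real"
  assumes "poly_fun k f"
  obtains q :: "real poly" where "f = poly q"
proof -
  have "\<exists>q. f = poly q" using assms
  proof (induction rule: poly_fun.induct)
    case (const k c)
    have "(\<lambda>z. c) = poly [:c:]" by auto
    then show ?case ..
  next
    case (mult k f b)
    then obtain q where "f = poly q" by auto
    then have "(\<lambda>z. (z \<bullet> b) *\<^sub>R f z) = poly ([:0, b:] * q)"
      by (auto simp: fun_eq_iff algebra_simps)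
    then show ?case ..
  next
    case (add k f g)
    then obtain q r where "f = poly q" "g = poly r" by auto
    then have "(\<lambda>z. f z + g z) = poly (q + r)" by (auto simp: fun_eq_iff)
    then show ?case ..
  qed
  then show ?thesis using that by blast
qed

lemma poly_fun_real_zero:
  fixes f :: "real \<Rightarrow> real"
  assumes "poly_fun k f" "infinite {x. f x = 0}"
  shows "f x = 0"
  using poly_fun_real_poly[OF assms(1)] poly_roots_finite assms(2) by (metis poly_0)

lemma poly_fun_line:
  fixes f :: "'a::euclidean_space \<Rightarrow> 'b::real_normed_vector"
  assumes "poly_fun k f"
  shows "poly_fun k (\<lambda>s. f (a + s *\<^sub>R e))"
  by (rule poly_fun_compose_affine[OF _ assms]) (auto intro: linearI simp: scaleR_add_left)

text \<open>On the line from the centre of a ball inside \<open>S\<close> to the given point, the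
  restriction is a polynomial in one variable that vanishes for all small parameters, hence also at
  parameter 1.\<close>

lemma poly_fun_eq_0_if_interior:
  fixes f :: "'a::euclidean_space \<Rightarrow> real"
  assumes f: "poly_fun k f" and S: "interior S \<noteq> {}" and 0: "\<And>z. z \<in> S \<Longrightarrow> f z = 0"
  shows "f z = 0"
proof -
  obtain a r where r: "r > 0" "ball a r \<subseteq> S"
    using S by (metis equals0I mem_interior)
  define g where "g = (\<lambda>s. f (a + s *\<^sub>R (z - a)))"
  \<comment> \<open>Parameters below \<open>d\<close> keep the point inside the ball; the summand 1
    covers the case \<open>z = a\<close>.\<close>
  define d where "d = r / (norm (z - a) + 1)"
  have np: "norm (z - a) + 1 > 0" by (metis add_nonneg_pos norm_ge_zero zero_less_one)
  have d: "d > 0" using r np by (simp add: d_def)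
  have "{0..<d} \<subseteq> {s. g s = 0}"
  proof
    fix s assume s: "s \<in> {0..<d}"
    have "s * norm (z - a) \<le> s * (norm (z - a) + 1)" using s by (intro mult_left_mono) auto
    also have "\<dots> < d * (norm (z - a) + 1)" using s np by (intro mult_strict_right_mono) auto
    also have "\<dots> = r" using np by (simp add: d_def)
    finally have "a + s *\<^sub>R (z - a) \<in> ball a r" using s by (simp add: dist_norm)
    then show "s \<in> {s. g s = 0}" using r 0 by (auto simp: g_def)
  qed
  moreover have "infinite {0..<d}" using d by simp
  ultimately have "infinite {s. g s = 0}" using finite_subset by blast
  then have "g 1 = 0" using poly_fun_real_zero poly_fun_line[OF f] unfolding g_def by blast
  then show ?thesis by (simp add: g_def)
qed

section \<open>Directional derivatives of polynomial maps, with space and time directions treated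
  alike\<close>

definition dir_deriv :: "'a::real_normed_vector \<Rightarrow> ('a \<Rightarrow> 'b::real_normed_vector) \<Rightarrow> 'a \<Rightarrow> 'b" where
  "dir_deriv e f z = frechet_derivative f (at z) e"

lemma poly_fun_differentiable: "poly_fun k f \<Longrightarrow> f differentiable at z"
  by (induction rule: poly_fun.induct) (auto intro!: derivative_intros differentiable_inner)

lemma poly_fun_has_derivative:
  "poly_fun k f \<Longrightarrow> (f has_derivative (\<lambda>e. dir_deriv e f z)) (at z)"
  using poly_fun_differentiable frechet_derivative_works unfolding dir_deriv_def by metis

lemma dir_deriv_eqI: "(f has_derivative f') (at z) \<Longrightarrow> dir_deriv e f z = f' e"
  unfolding dir_deriv_def using frechet_derivative_at by metis

lemma poly_fun_continuous: "poly_fun k f \<Longrightarrow> continuous_on A f"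
  by (meson differentiable_imp_continuous_within continuous_at_imp_continuous_on poly_fun_differentiable)

lemma dir_deriv_const [simp]: "dir_deriv e (\<lambda>z. c) = (\<lambda>z. 0)"
  by (rule ext, rule dir_deriv_eqI[of _ "\<lambda>_. 0", simplified]) (auto intro: derivative_intros)

lemma dir_deriv_add:
  assumes "poly_fun k f" "poly_fun m g"
  shows "dir_deriv e (\<lambda>z. f z + g z) = (\<lambda>z. dir_deriv e f z + dir_deriv e g z)"
  by (rule ext, rule dir_deriv_eqI)
     (auto intro!: derivative_intros poly_fun_has_derivative[OF assms(1)] poly_fun_has_derivative[OF assms(2)])

lemma dir_deriv_mult:
  assumes "poly_fun k f"
  shows "dir_deriv e (\<lambda>z. (z \<bullet> b) *\<^sub>R f z) = (\<lambda>z. (z \<bullet> b) *\<^sub>R dir_deriv e f z + (e \<bullet> b) *\<^sub>R f z)"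
  by (rule ext, rule dir_deriv_eqI)
     (auto intro!: derivative_eq_intros poly_fun_has_derivative[OF assms(1)])

text \<open>Between arbitrary normed spaces \<open>L\<close> may be discontinuous, so the chain rule
  does not apply; induction over the polynomial takes its place.\<close>

lemma dir_deriv_linear:
  fixes L :: "'b::real_normed_vector \<Rightarrow> 'c::real_normed_vector"
  assumes L: "linear L" and "poly_fun k f"
  shows "dir_deriv e (\<lambda>z. L (f z)) = (\<lambda>z. L (dir_deriv e f z))"
  using assms(2)
proof (induction rule: poly_fun.induct)
  case (const k c)
  show ?case by (simp add: linear_0[OF L])
next
  case (mult k f b)
  show ?case
    using mult.IH dir_deriv_mult[OF mult.hyps] dir_deriv_mult[OF poly_fun_linear[OF L mult.hyps]]
    by (simp add: linear_add[OF L] linear_scale[OF L])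
next
  case (add k f g)
  show ?case
    using add.IH dir_deriv_add[OF add.hyps]
      dir_deriv_add[OF poly_fun_linear[OF L add.hyps(1)] poly_fun_linear[OF L add.hyps(2)]]
    by (simp add: linear_add[OF L])
qed

lemma poly_fun_0D:
  assumes "poly_fun 0 f" obtains c where "f = (\<lambda>z. c)"
proof -
  have "\<exists>c. f = (\<lambda>z. c)" if "poly_fun m f" "m = 0" for m
    using that by (induction rule: poly_fun.induct) (auto simp: fun_eq_iff)
  then show ?thesis using assms that by blast
qed

lemma poly_fun_dir_deriv: "poly_fun k f \<Longrightarrow> poly_fun (k - 1) (dir_deriv e f)"
proof (induction rule: poly_fun.induct)
  case (const k c)
  then show ?case by (auto intro: poly_fun.intros)
next
  case (mult k f b)
  \<comment> \<open>For \<open>k = 0\<close> the subtraction in the induction hypothesis truncates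
    and multiplying by a coordinate would give the bound 1. In that case \<open>f\<close> is
    constant and the term vanishes.\<close>
  have "poly_fun k (\<lambda>z. (z \<bullet> b) *\<^sub>R dir_deriv e f z)"
  proof (cases k)
    case 0
    obtain c where "f = (\<lambda>z. c)" using poly_fun_0D mult.hyps 0 by metis
    then show ?thesis by (auto intro: poly_fun.intros)
  next
    case (Suc m)
    then show ?thesis using poly_fun.mult[OF mult.IH, of b] by simp
  qed
  moreover have "poly_fun k (\<lambda>z. (e \<bullet> b) *\<^sub>R f z)"
    by (rule poly_fun_linear[OF _ mult.hyps]) (auto intro: linearI simp: scaleR_add_right)
  ultimately show ?case unfolding dir_deriv_mult[OF mult.hyps] by (auto intro: poly_fun.add)
next
  case (add k f g)
  then show ?case unfolding dir_deriv_add[OF add.hyps] by (auto intro: poly_fun.add)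
qed

lemma dir_deriv_commute:
  "poly_fun k f \<Longrightarrow> dir_deriv e (dir_deriv e' f) = dir_deriv e' (dir_deriv e f)"
proof (induction rule: poly_fun.induct)
  case (mult k f b)
  \<comment> \<open>Apart from the second derivative of \<open>f\<close>, which the induction
    hypothesis handles, this expression is visibly symmetric in \<open>d\<close> and
    \<open>d'\<close>.\<close>
  have *: "dir_deriv d (\<lambda>z. (z \<bullet> b) *\<^sub>R dir_deriv d' f z + (d' \<bullet> b) *\<^sub>R f z) =
     (\<lambda>z. (z \<bullet> b) *\<^sub>R dir_deriv d (dir_deriv d' f) z + (d \<bullet> b) *\<^sub>R dir_deriv d' f z
       + (d' \<bullet> b) *\<^sub>R dir_deriv d f z)" for d d'
    by (subst dir_deriv_add[OF poly_fun.mult[OF poly_fun_dir_deriv[OF mult.hyps]]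
             poly_fun_linear[OF _ mult.hyps]])
       (auto simp: dir_deriv_mult[OF poly_fun_dir_deriv[OF mult.hyps]]
             dir_deriv_linear[OF bounded_linear.linear[OF bounded_linear_scaleR_right] mult.hyps]
             intro!: linearI simp: scaleR_add_right)
  show ?case
    unfolding dir_deriv_mult[OF mult.hyps] * mult.IH by (simp add: algebra_simps)
next
  case (add k f g)
  note P = poly_fun_dir_deriv[OF add.hyps(1)] poly_fun_dir_deriv[OF add.hyps(2)]
  show ?case
    unfolding dir_deriv_add[OF add.hyps] dir_deriv_add[OF P] add.IH ..
qed simp

lemma dir_deriv_sum:
  assumes "\<And>i. i \<in> A \<Longrightarrow> poly_fun k (f i)"
  shows "dir_deriv e (\<lambda>z. \<Sum>i\<in>A. f i z) = (\<lambda>z. \<Sum>i\<in>A. dir_deriv e (f i) z)"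
  by (rule ext, rule dir_deriv_eqI)
     (auto intro!: has_derivative_sum poly_fun_has_derivative assms)

lemma poly_fun_eq_const_if_dir_deriv_0:
  assumes u: "poly_fun k u" and S: "span S = UNIV" and 0: "\<And>d z. d \<in> S \<Longrightarrow> dir_deriv d u z = 0"
  obtains c where "u = (\<lambda>z. c)"
proof -
  have "dir_deriv d u z = 0" for d z
    using linear_eq_0_on_span[OF has_derivative_linear[OF poly_fun_has_derivative[OF u]] 0, of S d z] S
    by simp
  then have "(u has_derivative (\<lambda>_. 0)) (at z within UNIV)" for z
    using poly_fun_has_derivative[OF u, of z] by simp
  from has_derivative_zero_constant[OF convex_UNIV this] that show ?thesis by blast
qed

text \<open>The line through \<open>z\<close> in the direction \<open>f\<close> stays in the
  hyperplane, so the component is zero along it. Only one component \<open>b\<close> is involved,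
  which is why different components may vanish on different hyperplanes.\<close>

lemma dir_deriv_inner_eq_0_on_hyperplane:
  fixes u :: "'a::euclidean_space \<Rightarrow> 'b::euclidean_space"
  assumes u: "poly_fun k u" and f: "f \<bullet> e = 0"
    and s: "\<And>z. z \<bullet> e = s \<Longrightarrow> u z \<bullet> b = 0" and z: "z \<bullet> e = s"
  shows "dir_deriv f u z \<bullet> b = 0"
proof -
  have line: "((\<lambda>r. z + r *\<^sub>R f) has_derivative (\<lambda>r. r *\<^sub>R f)) (at 0)"
    by (auto intro!: derivative_eq_intros)
  have "((\<lambda>r. u (z + r *\<^sub>R f)) has_derivative (\<lambda>r. dir_deriv (r *\<^sub>R f) u z)) (at 0)"
    using has_derivative_compose[OF line, of u] poly_fun_has_derivative[OF u, of z] by simp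
  from has_derivative_inner_left[OF this, of b]
  have "((\<lambda>r. u (z + r *\<^sub>R f) \<bullet> b) has_derivative (\<lambda>r. dir_deriv (r *\<^sub>R f) u z \<bullet> b)) (at 0)" .
  moreover have "(\<lambda>r. u (z + r *\<^sub>R f) \<bullet> b) = (\<lambda>r. 0)"
    using s z f by (simp add: inner_add_left)
  ultimately have "((\<lambda>r :: real. 0 :: real) has_derivative (\<lambda>r. dir_deriv (r *\<^sub>R f) u z \<bullet> b)) (at 0)"
    by simp
  from has_derivative_unique[OF this has_derivative_const]
  have "dir_deriv (1 *\<^sub>R f) u z \<bullet> b = 0" by (rule fun_cong)
  then show ?thesis by simp
qed

text \<open>The maps \<open>A g\<close> do not depend on the point, so a further derivative passes
  through them and then commutes with the inner derivative.\<close>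

lemma dir_deriv_of_evolution_equation:
  assumes u: "poly_fun k u" and A: "\<And>g. g \<in> F \<Longrightarrow> linear (A g)"
    and eq: "\<And>z. dir_deriv e u z = (\<Sum>g\<in>F. A g (dir_deriv g u z))"
  shows "dir_deriv e (dir_deriv f u) z = (\<Sum>g\<in>F. A g (dir_deriv g (dir_deriv f u) z))"
proof -
  note d = poly_fun_dir_deriv[OF u]
  have "dir_deriv e (dir_deriv f u) = dir_deriv f (\<lambda>z. \<Sum>g\<in>F. A g (dir_deriv g u z))"
    unfolding dir_deriv_commute[OF u, of e f] using eq by presburger
  also have "\<dots> = (\<lambda>z. \<Sum>g\<in>F. dir_deriv f (\<lambda>z. A g (dir_deriv g u z)) z)"
    by (rule dir_deriv_sum[OF poly_fun_linear[OF A d]])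
  also have "\<dots> = (\<lambda>z. \<Sum>g\<in>F. A g (dir_deriv g (dir_deriv f u) z))"
    by (intro ext sum.cong refl) (simp only: dir_deriv_linear[OF A d] dir_deriv_commute[OF u, of f])
  finally show ?thesis by (rule fun_cong)
qed

subsection \<open>Hausdorff measure of planar sets\<close>

lemma diameter_lipschitz_cube_le:
  fixes f :: "real \<times> real \<Rightarrow> 'a::real_normed_vector"
  assumes f: "K-lipschitz_on UNIV f" and s: "s \<ge> 0"
  shows "(diameter (f ` cbox (a, b) (a + s, b + s)))\<^sup>2 \<le> 2 * K\<^sup>2 * s\<^sup>2"
proof -
  have K: "K \<ge> 0" using f lipschitz_on_nonneg by blast
  have "norm (f x - f y) \<le> K * (sqrt 2 * s)"
    if "x \<in> cbox (a, b) (a + s, b + s)" "y \<in> cbox (a, b) (a + s, b + s)" for x y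
  proof -
    have "\<bar>fst x - fst y\<bar> \<le> s" "\<bar>snd x - snd y\<bar> \<le> s"
      using that by (auto simp: cbox_Pair_eq)
    then have "(fst x - fst y)\<^sup>2 \<le> s\<^sup>2" "(snd x - snd y)\<^sup>2 \<le> s\<^sup>2"
      using s by (metis abs_le_square_iff abs_of_nonneg)+
    then have "norm (x - y) \<le> sqrt (2 * s\<^sup>2)"
      by (auto simp: norm_prod_def)
    also have "\<dots> = sqrt 2 * s" using s by (simp add: real_sqrt_mult)
    finally have "norm (x - y) \<le> sqrt 2 * s" .
    moreover have "norm (f x - f y) \<le> K * norm (x - y)"
      using lipschitz_onD[OF f, of x y] by (simp add: dist_norm)
    ultimately show ?thesis using K by (meson mult_left_mono order_trans)
  qed
  then have "diameter (f ` cbox (a, b) (a + s, b + s)) \<le> K * (sqrt 2 * s)"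
    by (intro diameter_le) (use K s in auto)
  moreover have "diameter (f ` cbox (a, b) (a + s, b + s)) \<ge> 0"
    by (intro diameter_ge_0 compact_imp_bounded compact_continuous_image
        lipschitz_on_continuous_on[OF lipschitz_on_subset[OF f]]) auto
  ultimately have "(diameter (f ` cbox (a, b) (a + s, b + s)))\<^sup>2 \<le> (K * (sqrt 2 * s))\<^sup>2"
    by (intro power_mono)
  then show ?thesis by (simp add: power_mult_distrib mult_ac)
qed

text \<open>\<open>B\<close> is covered by countably many small non-overlapping squares inside
  \<open>T\<close>, and their images cover \<open>A\<close>. A square of side s has an image of
  squared diameter at most 2 K^2 s^2; with the normalization pi/4 this gives the factor pi/2 K^2. A
  bound up to a constant suffices for null sets and for finiteness, so squares may replace efficient
  coverings.\<close>

lemma hausdorff2_premeasure_lipschitz_image_le: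
  fixes f :: "real \<times> real \<Rightarrow> real^3"
  assumes f: "K-lipschitz_on UNIV f" and K: "K > 0" and \<delta>: "\<delta> > 0"
    and B: "bounded B" and T: "open T" "B \<subseteq> T" and A: "A \<subseteq> f ` B"
  shows "hausdorff2_premeasure \<delta> A \<le> ennreal (pi / 2 * K\<^sup>2) * emeasure lborel T"
proof -
  obtain c where c: "c > 0" "B \<subseteq> cbox (-c, -c) (c, c)"
  proof -
    obtain c where c: "c > 0" "\<forall>x\<in>B. norm x \<le> c" using B bounded_pos by blast
    have "\<bar>fst x\<bar> \<le> c" "\<bar>snd x\<bar> \<le> c" if "x \<in> B" for x
      using c(2) that norm_fst_le[of "fst x" "snd x"] norm_snd_le[of "snd x" "fst x"] by force+
    then have "B \<subseteq> cbox (-c, -c) (c, c)"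
      by (fastforce simp: cbox_Pair_eq abs_le_iff minus_le_iff)
    then show ?thesis using that c by blast
  qed
  \<comment> \<open>The radius makes the image of a ball have diameter at most
    \<open>\<delta>\<close>, and the intersection keeps the squares inside \<open>T\<close>. The
    tags of the covering lie in \<open>B\<close>, hence in \<open>T\<close>, so the second branch
    only makes \<open>g\<close> a gauge.\<close>
  define g where
    "g = (\<lambda>x. (if x \<in> T then T \<inter> ball x (\<delta> / (2 * K)) else ball x 1))"
  have "gauge g"
    unfolding gauge_def g_def using T \<delta> K by auto
  moreover have "box (-c, -c) (c, c) \<noteq> {}"
    using c by (auto simp: box_ne_empty Basis_prod_def)
  ultimately obtain \<D> where \<D>: "countable \<D>"
    "\<And>Q. Q \<in> \<D> \<Longrightarrow> interior Q \<noteq> {} \<and> (\<exists>u v. Q = cbox u v)"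
    "pairwise (\<lambda>A B. interior A \<inter> interior B = {}) \<D>"
    "\<And>Q. Q \<in> \<D> \<Longrightarrow> \<exists>x \<in> B \<inter> Q. Q \<subseteq> g x"
    "\<And>u v. cbox u v \<in> \<D> \<Longrightarrow> \<exists>n. \<forall>i \<in> Basis. v \<bullet> i - u \<bullet> i = ((c, c) \<bullet> i - (-c, -c) \<bullet> i) / 2^n"
    "B \<subseteq> \<Union>\<D>"
    using covering_lemma[OF c(2), of g] by metis
  \<comment> \<open>The initial box has equal sides and is divided with the same exponent in both
    coordinates, so all pieces are squares.\<close>
  have cube: "\<exists>a b s. s > 0 \<and> Q = cbox (a, b) (a + s, b + s)" if Q: "Q \<in> \<D>" for Q
  proof -
    obtain u v where uv: "Q = cbox u v" using \<D>(2) Q by blast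
    then obtain n where n: "\<forall>i \<in> Basis. v \<bullet> i - u \<bullet> i = ((c, c) \<bullet> i - (-c, -c) \<bullet> i) / 2^n"
      using \<D>(5) Q by blast
    have "fst v - fst u = 2 * c / 2 ^ n" "snd v - snd u = 2 * c / 2 ^ n"
      using n[rule_format, of "(1, 0)"] n[rule_format, of "(0, 1)"]
      by (auto simp: Basis_prod_def inner_prod_def)
    then have "v = (fst u + 2 * c / 2 ^ n, snd u + 2 * c / 2 ^ n)"
      by (metis add.commute diff_add_cancel prod.collapse)
    moreover have "2 * c / 2 ^ n > 0" using c by simp
    ultimately show ?thesis using uv by (metis prod.collapse)
  qed
  \<comment> \<open>An enumeration of the squares by all natural numbers; indices that are not hit,
    as happens when there are finitely many squares, get the empty set, which contributes 0.\<close>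
  define E where "E = (\<lambda>i. if i \<in> to_nat_on \<D> ` \<D> then from_nat_into \<D> i else {})"
  have E: "E i = {} \<or> E i \<in> \<D>" for i
    by (auto simp: E_def \<D>(1))
  have E_disj: "disjoint_family (\<lambda>i. interior (E i))"
    unfolding disjoint_family_on_def
  proof (intro ballI impI)
    fix i j :: nat assume "i \<noteq> j"
    show "interior (E i) \<inter> interior (E j) = {}"
    proof (cases "i \<in> to_nat_on \<D> ` \<D> \<and> j \<in> to_nat_on \<D> ` \<D>")
      case True
      then obtain P Q where PQ: "P \<in> \<D>" "i = to_nat_on \<D> P" "Q \<in> \<D>" "j = to_nat_on \<D> Q" by blast
      then have "E i = P" "E j = Q" using \<D>(1) by (auto simp: E_def)
      moreover have "P \<noteq> Q" using PQ \<open>i \<noteq> j\<close> by auto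
      ultimately show ?thesis using \<D>(3) PQ by (auto simp: pairwise_def)
    qed (auto simp: E_def)
  qed
  have E_g: "\<exists>x. E i \<subseteq> T \<inter> ball x (\<delta> / (2 * K))" for i
  proof (cases "E i = {}")
    case False
    then obtain x where "x \<in> B \<inter> E i" "E i \<subseteq> g x" using E \<D>(4) by blast
    moreover then have "x \<in> T" using T by auto
    ultimately have "E i \<subseteq> T \<inter> ball x (\<delta> / (2 * K))" by (simp add: g_def)
    then show ?thesis by blast
  qed auto
  have "hausdorff2_premeasure \<delta> A \<le> (\<Sum>i. ennreal (pi / 4 * (diameter (f ` E i))\<^sup>2))"
    unfolding hausdorff2_premeasure_def
  proof (rule INF_lower, safe)
    fix x assume "x \<in> A"
    then obtain y where y: "y \<in> B" "x = f y" using A by blast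
    then obtain Q where Q: "Q \<in> \<D>" "y \<in> Q" using \<D>(6) by blast
    then have "E (to_nat_on \<D> Q) = Q" using \<D>(1) by (auto simp: E_def)
    then show "x \<in> (\<Union>i. f ` E i)" using y Q by blast
  next
    fix i
    obtain x where x: "E i \<subseteq> ball x (\<delta> / (2 * K))" using E_g by blast
    have d: "norm (f y - f z) \<le> \<delta>" if "y \<in> E i" "z \<in> E i" for y z
    proof -
      have "dist y z < \<delta> / (2 * K) + \<delta> / (2 * K)"
        using x that by (metis dist_triangle_less_add mem_ball subsetD dist_commute)
      then have "dist y z \<le> \<delta> / K" by (simp add: field_simps)
      then have "K * dist y z \<le> \<delta>" using K by (simp add: field_simps)
      then show ?thesis using lipschitz_onD[OF f, of y z] by (simp add: dist_norm)
    qed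
    then show "diameter (f ` E i) \<le> \<delta>" using \<delta> by (intro diameter_le) auto
    have "dist (f y) (f z) \<le> \<delta>" if "y \<in> E i" "z \<in> E i" for y z
      using d[OF that] by (simp add: dist_norm)
    then show "bounded (f ` E i)"
      unfolding bounded_two_points by blast
  qed
  \<comment> \<open>The squares may share edges, but their interiors are disjoint and have the same
    area, so interiors are what is summed.\<close>
  also have "\<dots> \<le> (\<Sum>i. ennreal (pi / 2 * K\<^sup>2) * emeasure lborel (interior (E i)))"
  proof (intro suminf_le summableI)
    fix i
    show "ennreal (pi / 4 * (diameter (f ` E i))\<^sup>2)
        \<le> ennreal (pi / 2 * K\<^sup>2) * emeasure lborel (interior (E i))"
    proof (cases "E i = {}")
      case False
      then obtain a b s where s: "s > 0" "E i = cbox (a, b) (a + s, b + s)" using E cube by blast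
      have "emeasure lborel (interior (E i)) = ennreal (s\<^sup>2)"
        unfolding s(2) interior_cbox using s(1)
        by (subst emeasure_lborel_box) (auto simp: Basis_prod_def prod.union_disjoint power2_eq_square
             inner_prod_def prod.reindex)
      moreover have "pi / 4 * (diameter (f ` E i))\<^sup>2 \<le> (pi / 2 * K\<^sup>2) * s\<^sup>2"
        using mult_left_mono[OF diameter_lipschitz_cube_le[OF f, of s a b], of "pi / 4"] s
        by simp
      ultimately show ?thesis
        by (metis (no_types) ennreal_leI ennreal_mult' ennreal_mult'' zero_le_power2)
    qed simp
  qed
  also have "\<dots> = ennreal (pi / 2 * K\<^sup>2) * emeasure lborel (\<Union>i. interior (E i))"
    by (subst ennreal_suminf_cmult, subst suminf_emeasure) (auto intro: E_disj)
  also have "\<dots> \<le> ennreal (pi / 2 * K\<^sup>2) * emeasure lborel T"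
  proof (intro mult_left_mono emeasure_mono)
    show "(\<Union>i. interior (E i)) \<subseteq> T" using E_g interior_subset by blast
    show "T \<in> sets lborel" using T by simp
  qed simp
  finally show ?thesis .
qed

lemma hausdorff2_lipschitz_image_le:
  fixes f :: "real \<times> real \<Rightarrow> real^3"
  assumes "K-lipschitz_on UNIV f" and "K > 0"
    and "bounded B" and "open T" "B \<subseteq> T" and "A \<subseteq> f ` B"
  shows "hausdorff2 A \<le> ennreal (pi / 2 * K\<^sup>2) * emeasure lborel T"
  unfolding hausdorff2_def
  by (intro SUP_least hausdorff2_premeasure_lipschitz_image_le[OF assms(1,2) _ assms(3-6)]) auto

text \<open>By outer regularity, the null set \<open>B\<close> lies in open sets of arbitrarily
  small measure, and the previous bound applies to each of them.\<close>

lemma hausdorff2_lipschitz_image_null: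
  fixes f :: "real \<times> real \<Rightarrow> real^3"
  assumes f: "K-lipschitz_on UNIV f" "K > 0"
    and B: "bounded B" "B \<in> null_sets lborel" and A: "A \<subseteq> f ` B"
  shows "hausdorff2 A = 0"
proof -
  have "hausdorff2 A \<le> ennreal e" if e: "e > 0" for e
  proof -
    define c where "c = pi / 2 * K\<^sup>2"
    have c: "c > 0" using f by (simp add: c_def)
    obtain U where U: "open U" "B \<subseteq> U" "emeasure lborel (U - B) < ennreal (e / c)"
      using outer_regular_lborel[of B "e / c"] B c e by (metis divide_pos_pos null_setsD2 sets_lborel)
    have "emeasure lborel U = emeasure lborel (U - B)"
      using B U by (intro emeasure_Diff_null_set[symmetric]) auto
    then have "ennreal c * emeasure lborel U \<le> ennreal c * ennreal (e / c)"
      using U by (intro mult_left_mono) auto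
    also have "\<dots> = ennreal e" using c e by (simp flip: ennreal_mult)
    finally show ?thesis
      using hausdorff2_lipschitz_image_le[OF f B(1) U(1,2) A] unfolding c_def by order
  qed
  then show ?thesis
    by (metis ennreal_le_epsilon add_0 le_zero_eq)
qed

text \<open>This holds without knowing that \<open>hausdorff2\<close> is countably additive: otherwise \<open>measure_of\<close>
  would give the zero measure.\<close>

lemma emeasure_surface_measure_le: "emeasure surface_measure A \<le> hausdorff2 A"
  unfolding surface_measure_def by (simp add: emeasure_measure_of_conv)

lemma sets_surface_measure [simp, measurable_cong]: "sets surface_measure = sets borel"
  and space_surface_measure [simp]: "space surface_measure = UNIV"
  unfolding surface_measure_def
  by (metis sets.sigma_sets_eq sets_measure_of space_borel subset_UNIV Pow_UNIV)
     (simp add: space_measure_of_conv)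

section \<open>Polynomials on planar pieces of positive area\<close>

text \<open>Fubini with one-dimensional root counting: on the horizontal line through a non-zero
  only finitely many x are roots, and over each other x the vertical line carries finitely many
  roots.\<close>

lemma poly_fun_zeros_null:
  fixes f :: "real \<times> real \<Rightarrow> real"
  assumes f: "poly_fun k f" and nz: "f w \<noteq> 0"
  shows "{z. f z = 0} \<in> null_sets lborel"
proof -
  obtain a b where w: "w = (a, b)" by fastforce
  have p1: "poly_fun k (\<lambda>x. f (x, b))"
    using poly_fun_line[OF f, of "(0, b)" "(1, 0)"] by simp
  have p2: "poly_fun k (\<lambda>y. f (x, y))" for x
    using poly_fun_line[OF f, of "(x, 0)" "(0, 1)"] by simp
  have cl: "closed {z. f z = 0}"
    using poly_fun_continuous[OF f, of UNIV] by (intro closed_Collect_eq) auto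
  have "finite {x. f (x, b) = 0}"
    using poly_fun_real_zero[OF p1, of a] nz w by auto
  then have "AE x in lborel. f (x, b) \<noteq> 0"
    by (intro AE_I'[of "{x. f (x, b) = 0}"] finite_imp_null_set_lborel) auto
  then have "AE x in lborel. AE y in lborel. f (x, y) \<noteq> 0"
  proof (eventually_elim)
    case (elim x)
    then have "finite {y. f (x, y) = 0}"
      using poly_fun_real_zero[OF p2, of x b] by auto
    then show ?case
      by (intro AE_I'[of "{y. f (x, y) = 0}"] finite_imp_null_set_lborel) auto
  qed
  moreover have "{z \<in> space (lborel \<Otimes>\<^sub>M lborel). f z \<noteq> 0} \<in> sets (lborel \<Otimes>\<^sub>M lborel)"
    unfolding lborel_prod using cl by (simp add: Collect_neg_eq)
  ultimately have "AE z in lborel \<Otimes>\<^sub>M lborel. f z \<noteq> 0"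
    by (intro lborel_pair.AE_pair_measure)
  then have "AE z in lborel. z \<notin> {z. f z = 0}" unfolding lborel_prod by simp
  then show ?thesis
    using cl by (subst AE_iff_null_sets) auto
qed

lemma plane_parametrization:
  fixes \<nu> :: "real^3"
  assumes "norm \<nu> = 1"
  obtains u v where "norm u = 1" "norm v = 1"
    "\<forall>x. x = (\<nu> \<bullet> x) *\<^sub>R \<nu> + ((x \<bullet> u) *\<^sub>R u + (x \<bullet> v) *\<^sub>R v)"
proof -
  obtain S where S: "pairwise orthogonal S" "\<And>x. x \<in> S \<Longrightarrow> norm x = 1"
      "independent S" "card S = DIM(real^3)" "span S = UNIV" "\<nu> \<in> S"
    using vector_in_orthonormal_basis[OF assms] by metis
  have "finite S" using S(3) independent_imp_finite by blast
  have "card (S - {\<nu>}) = 2" using S(4,6) \<open>finite S\<close> by simp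
  then obtain u v where uv: "S - {\<nu>} = {u, v}" "u \<noteq> v" by (auto simp: card_2_iff)
  then have SS: "S = {\<nu>, u, v}" "\<nu> \<noteq> u" "\<nu> \<noteq> v" using S(6) by auto
  have "x = (\<nu> \<bullet> x) *\<^sub>R \<nu> + ((x \<bullet> u) *\<^sub>R u + (x \<bullet> v) *\<^sub>R v)" for x
    using orthonormal_basis_expand[OF S(1,2), of x] S(5) \<open>finite S\<close> SS uv(2)
    by (auto simp: inner_commute)
  moreover have "norm u = 1" "norm v = 1" using S(2) SS by auto
  ultimately show ?thesis using that by blast
qed

text \<open>The crude constant 2 comes from bounding each coordinate by the norm, so
  \<open>u\<close> and \<open>v\<close> only have to be unit vectors.\<close>

lemma lipschitz_plane_parametrization:
  assumes "norm u = 1" "norm v = 1"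
  shows "2-lipschitz_on UNIV (\<lambda>y :: real \<times> real. w + (fst y *\<^sub>R u + snd y *\<^sub>R v))"
proof (rule lipschitz_onI)
  fix x y :: "real \<times> real"
  have "w + (fst x *\<^sub>R u + snd x *\<^sub>R v) - (w + (fst y *\<^sub>R u + snd y *\<^sub>R v))
      = (fst (x - y)) *\<^sub>R u + (snd (x - y)) *\<^sub>R v"
    by (simp add: algebra_simps)
  also have "norm \<dots> \<le> \<bar>fst (x - y)\<bar> + \<bar>snd (x - y)\<bar>"
    using assms by (metis norm_scaleR mult.right_neutral norm_triangle_ineq)
  also have "\<dots> \<le> 2 * norm (x - y)"
    using norm_fst_le[of "fst (x - y)" "snd (x - y)"] norm_snd_le[of "snd (x - y)" "fst (x - y)"]
    unfolding prod.collapse real_norm_def by linarith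
  finally show "dist (w + (fst x *\<^sub>R u + snd x *\<^sub>R v)) (w + (fst y *\<^sub>R u + snd y *\<^sub>R v)) \<le> 2 * dist x y"
    by (simp add: dist_norm)
qed simp

lemma bounded_plane_coordinates:
  fixes S :: "(real^3) set"
  assumes "bounded S"
  shows "bounded ((\<lambda>x. (x \<bullet> u, x \<bullet> v)) ` S)"
  using assms by (intro bounded_linear_image) (auto intro!: bounded_linear_Pair bounded_linear_inner_left)

text \<open>Finite area makes bounded fields square integrable on an interface and gives the finite
  measure needed for Fubini.\<close>

lemma emeasure_surface_measure_planar_finite:
  assumes "norm \<nu> = 1" "\<forall>x\<in>S. \<nu> \<bullet> x = d" "bounded S"
  shows "emeasure surface_measure S < \<infinity>"
proof -
  obtain u v where uv: "norm u = 1" "norm v = 1"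
    and e: "\<forall>x. x = (\<nu> \<bullet> x) *\<^sub>R \<nu> + ((x \<bullet> u) *\<^sub>R u + (x \<bullet> v) *\<^sub>R v)"
    using plane_parametrization[OF assms(1)] .
  define B where "B = (\<lambda>x. (x \<bullet> u, x \<bullet> v)) ` S"
  have B: "bounded B" unfolding B_def by (rule bounded_plane_coordinates[OF assms(3)])
  then obtain r where r: "B \<subseteq> ball 0 r" using bounded_subset_ballD by blast
  have "S \<subseteq> (\<lambda>y. d *\<^sub>R \<nu> + (fst y *\<^sub>R u + snd y *\<^sub>R v)) ` B"
  proof
    fix x assume "x \<in> S"
    then have "x = d *\<^sub>R \<nu> + (fst (x \<bullet> u, x \<bullet> v) *\<^sub>R u + snd (x \<bullet> u, x \<bullet> v) *\<^sub>R v)"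
      using e[rule_format, of x] assms(2) by simp
    then show "x \<in> (\<lambda>y. d *\<^sub>R \<nu> + (fst y *\<^sub>R u + snd y *\<^sub>R v)) ` B"
      using \<open>x \<in> S\<close> unfolding B_def by blast
  qed
  from hausdorff2_lipschitz_image_le[OF lipschitz_plane_parametrization[OF uv] _ B open_ball r this]
  have "hausdorff2 S \<le> ennreal (pi / 2 * 2\<^sup>2) * emeasure lborel (ball (0 :: real \<times> real) r)" by simp
  also have "\<dots> < \<infinity>"
    using emeasure_lborel_ball_finite[of "0 :: real \<times> real" r] by (simp add: ennreal_mult_less_top)
  finally show ?thesis using emeasure_surface_measure_le order_le_less_trans by blast
qed

lemma poly_fun_eq_0_if_planar_AE:
  fixes g :: "real^3 \<Rightarrow> real"
  assumes g: "poly_fun k g" and \<nu>: "norm \<nu> = 1" "\<forall>x\<in>S. \<nu> \<bullet> x = d" and S: "bounded S" "S \<in> sets borel"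
    and pos: "emeasure surface_measure S > 0"
    and ae: "AE x in surface_measure. x \<in> S \<longrightarrow> g x = 0"
    and x: "\<nu> \<bullet> x = d"
  shows "g x = 0"
proof (rule ccontr)
  assume nz: "g x \<noteq> 0"
  obtain u v where uv: "norm u = 1" "norm v = 1"
    and e: "\<forall>x. x = (\<nu> \<bullet> x) *\<^sub>R \<nu> + ((x \<bullet> u) *\<^sub>R u + (x \<bullet> v) *\<^sub>R v)"
    using plane_parametrization[OF \<nu>(1)] .
  define f where "f = (\<lambda>y. d *\<^sub>R \<nu> + (fst y *\<^sub>R u + snd y *\<^sub>R v))"
  have fe: "x = f (x \<bullet> u, x \<bullet> v)" if "\<nu> \<bullet> x = d" for x
    using e[rule_format, of x] that by (simp add: f_def)
  define B where "B = (\<lambda>x. (x \<bullet> u, x \<bullet> v)) ` S"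
  have B: "bounded B" unfolding B_def by (rule bounded_plane_coordinates[OF S(1)])
  then obtain r where r: "B \<subseteq> ball 0 r" using bounded_subset_ballD by blast
  have "linear (\<lambda>y. fst y *\<^sub>R u + snd y *\<^sub>R v)"
    by (auto intro!: linearI simp: algebra_simps)
  from poly_fun_compose_affine[OF this g, of "d *\<^sub>R \<nu>"]
  have "poly_fun k (\<lambda>y. g (f y))" by (simp add: f_def)
  moreover have "g (f (x \<bullet> u, x \<bullet> v)) \<noteq> 0" using nz fe[OF x] by simp
  ultimately have "{y. g (f y) = 0} \<in> null_sets lborel" using poly_fun_zeros_null by blast
  \<comment> \<open>The comparison with Hausdorff measure is for bounded sets; the ball contains the
    coordinates of all of \<open>S\<close>, so nothing is lost.\<close>
  then have N: "{y. g (f y) = 0} \<inter> ball 0 r \<in> null_sets lborel"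
    by (rule null_set_Int2) simp
  define S' where "S' = {x \<in> S. g x = 0}"
  have gm: "g \<in> borel_measurable borel"
    by (rule borel_measurable_continuous_onI[OF poly_fun_continuous[OF g]])
  have S'm: "S' \<in> sets borel" unfolding S'_def using S(2) gm by measurable
  have "S' \<subseteq> f ` ({y. g (f y) = 0} \<inter> ball 0 r)"
  proof
    fix x assume "x \<in> S'"
    then have *: "x \<in> S" "g x = 0" by (auto simp: S'_def)
    then have "(x \<bullet> u, x \<bullet> v) \<in> ball 0 r" using r unfolding B_def by blast
    moreover have "x = f (x \<bullet> u, x \<bullet> v)" using * \<nu> fe by blast
    ultimately show "x \<in> f ` ({y. g (f y) = 0} \<inter> ball 0 r)" using * by force
  qed
  then have "hausdorff2 S' = 0"
    using hausdorff2_lipschitz_image_null[OF lipschitz_plane_parametrization[OF uv] _ _ N]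
    unfolding f_def by (simp add: bounded_Int)
  then have "emeasure surface_measure S' = 0"
    using emeasure_surface_measure_le[of S'] by simp
  then have "S' \<in> null_sets surface_measure" using S'm by auto
  then have "AE x in surface_measure. x \<notin> S'" by (rule AE_not_in)
  with ae have "AE x in surface_measure. x \<notin> S" by eventually_elim (auto simp: S'_def)
  then have "emeasure surface_measure S = 0"
    using S(2) by (simp add: AE_iff_measurable[of S])
  then show False using pos by simp
qed

subsection \<open>Quadratic functionals on finite-dimensional spaces\<close>

text \<open>The part of \<open>U\<close> in the smaller span has codimension at most one in
  \<open>U\<close>, and \<open>u\<close> generates a complement. The coefficient b/a cancels the
  multiples of \<open>e\<close> in \<open>x\<close> and \<open>u\<close>; a = 0 would put
  \<open>u\<close> into the smaller span.\<close>

lemma subspace_reduce_modulo_span: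
  fixes sc :: "'a::field \<Rightarrow> 'v::ab_group_add \<Rightarrow> 'v"
  assumes sc: "module sc"
    and U: "module.subspace sc U" "U \<subseteq> module.span sc (insert e t)"
    and u: "u \<in> U" "u \<notin> module.span sc t" and x: "x \<in> U"
  obtains r where "x - sc r u \<in> U \<inter> module.span sc t"
proof -
  note span = module.span_diff[OF sc] module.span_scale[OF sc]
  obtain a where a: "u - sc a e \<in> module.span sc t"
    using U(2) u(1) module.span_breakdown_eq[OF sc] by blast
  obtain b where b: "x - sc b e \<in> module.span sc t"
    using U(2) x module.span_breakdown_eq[OF sc] by blast
  have "a \<noteq> 0" using a u(2) by (auto simp: module.scale_zero_left[OF sc])
  then have "x - sc (b / a) u = (x - sc b e) - sc (b / a) (u - sc a e)"
    by (simp add: module.scale_right_diff_distrib[OF sc] module.scale_scale[OF sc])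
  also have "\<dots> \<in> module.span sc t" using span(1)[OF b span(2)[OF a]] .
  finally have "x - sc (b / a) u \<in> module.span sc t" .
  moreover have "x - sc (b / a) u \<in> U"
    using module.subspace_diff[OF sc U(1) x module.subspace_scale[OF sc U(1) u(1)]] .
  ultimately show ?thesis using that by blast
qed

text \<open>Symmetry is included, so linearity in the first argument suffices. The laws are relative
  to \<open>U\<close> because additivity of the integrals is available only for fields known to be
  square integrable. The scalar multiplication is a parameter so that the notion applies to fields,
  which are plain functions.\<close>

definition bilinear_form_on :: "(real \<Rightarrow> 'v \<Rightarrow> 'v) \<Rightarrow> 'v::ab_group_add set \<Rightarrow> ('v \<Rightarrow> 'v \<Rightarrow> real) \<Rightarrow> bool" where
  "bilinear_form_on sc U B \<longleftrightarrow>
     (\<forall>x\<in>U. \<forall>y\<in>U. B x y = B y x) \<and>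
     (\<forall>x\<in>U. \<forall>y\<in>U. \<forall>z\<in>U. B (x + y) z = B x z + B y z) \<and>
     (\<forall>r. \<forall>x\<in>U. \<forall>y\<in>U. B (sc r x) y = r * B x y)"

definition linear_form_on :: "(real \<Rightarrow> 'v \<Rightarrow> 'v) \<Rightarrow> 'v::ab_group_add set \<Rightarrow> ('v \<Rightarrow> real) \<Rightarrow> bool" where
  "linear_form_on sc U L \<longleftrightarrow>
     (\<forall>x\<in>U. \<forall>y\<in>U. L (x + y) = L x + L y) \<and> (\<forall>r. \<forall>x\<in>U. L (sc r x) = r * L x)"

text \<open>A Gram-Schmidt induction over the spanning set: \<open>U\<close> is either unchanged by
  dropping \<open>e\<close>, or it is the sum of the smaller space \<open>W\<close> and a line that
  is \<open>B\<close>-orthogonal to \<open>W\<close>. The spanning set need not lie in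
  \<open>U\<close>.\<close>

lemma riesz_finite_dim:
  fixes sc :: "real \<Rightarrow> 'v::ab_group_add \<Rightarrow> 'v"
  assumes "vector_space sc" and "finite t"
    and "module.subspace sc U" "U \<subseteq> module.span sc t"
    and "bilinear_form_on sc U B" and "linear_form_on sc U L"
    and "\<And>x. x \<in> U \<Longrightarrow> x \<noteq> 0 \<Longrightarrow> B x x > 0"
  shows "\<exists>d\<in>U. \<forall>x\<in>U. B d x = L x"
proof -
  have m: "module sc" using assms(1) by (simp add: module_iff_vector_space)
  note subspace = module.subspace_0[OF m] module.subspace_add[OF m] module.subspace_diff[OF m]
    module.subspace_scale[OF m] module.subspace_inter[OF m] module.subspace_span[OF m]
  show ?thesis using assms(2-)
  proof (induction t arbitrary: U L)
    case empty
    have "0 \<in> U" using empty.prems(1) by (rule subspace(1))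
    then have "U = {0}" using empty.prems(2) module.span_empty[OF m] by auto
    moreover have "L 0 = 0" "B 0 0 = 0"
      using empty.prems(3,4) \<open>0 \<in> U\<close> unfolding bilinear_form_on_def linear_form_on_def
      by (metis add_cancel_right_right)+
    ultimately show ?case by auto
  next
    case (insert e t)
    note sub = insert.prems(1) and B = insert.prems(3)[unfolded bilinear_form_on_def]
      and L = insert.prems(4)[unfolded linear_form_on_def] and pos = insert.prems(5)
    define W where "W = U \<inter> module.span sc t"
    have W: "module.subspace sc W" "W \<subseteq> module.span sc t" "W \<subseteq> U"
      using sub subspace(5,6) by (auto simp: W_def)
    have BW: "bilinear_form_on sc W B"
      using B W(3) unfolding bilinear_form_on_def by blast
    have IH: "\<exists>d\<in>W. \<forall>x\<in>W. B d x = L' x" if "linear_form_on sc W L'" for L'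
      using insert.IH[OF W(1,2) BW that] pos W(3) by blast
    show ?case
    proof (cases "U \<subseteq> module.span sc t")
      case True
      then have "U = W" by (auto simp: W_def)
      then show ?thesis using IH insert.prems(4) by simp
    next
      case False
      then obtain u where u: "u \<in> U" "u \<notin> module.span sc t" by blast
      \<comment> \<open>The induction hypothesis for this form yields the
        \<open>B\<close>-orthogonal projection \<open>q\<close> of \<open>u\<close> onto
        \<open>W\<close>; the difference \<open>v\<close> is then orthogonal to
        \<open>W\<close>.\<close>
      have "linear_form_on sc W (B u)"
        using B W u(1) subspace(2,4)[OF sub]
        unfolding linear_form_on_def by (metis subsetD)
      from IH[OF this] obtain q where q: "q \<in> W" "\<forall>x\<in>W. B q x = B u x" by blast
      have "linear_form_on sc W L" using L W(3) unfolding linear_form_on_def by blast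
      from IH[OF this] obtain d0 where d0: "d0 \<in> W" "\<forall>x\<in>W. B d0 x = L x" by blast
      define v where "v = u - q"
      have v: "v \<in> U" "v \<notin> module.span sc t" unfolding v_def
        using u q W subspace(3)[OF sub] module.span_add_eq2[OF m, of q t "u - q"]
        by (auto simp: subset_iff)
      have orth: "B v w = 0" if "w \<in> W" for w
      proof -
        have "B (v + q) w = B v w + B q w" using B v q W that by blast
        then show ?thesis using q that by (simp add: v_def)
      qed
      have Bv: "B v v > 0" using pos v module.span_zero[OF m] by metis
      \<comment> \<open>The multiple of \<open>v\<close> corrects the value at \<open>v\<close> and,
        by orthogonality, leaves the values on \<open>W\<close> as they are.\<close>
      define d where "d = d0 + sc ((L v - B d0 v) / B v v) v"
      have sv: "sc r v \<in> U" for r using sub v by (simp add: subspace(4))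
      have d0U: "d0 \<in> U" using d0 W by auto
      have dU: "d \<in> U" unfolding d_def using sub d0U sv by (simp add: subspace(2))
      have Bd: "B d x = B d0 x + (L v - B d0 v) / B v v * B v x" if "x \<in> U" for x
        unfolding d_def using B d0U sv v that by metis
      have "B d x = L x" if x: "x \<in> U" for x
      proof -
        obtain r where r: "x - sc r v \<in> W"
          using subspace_reduce_modulo_span[OF m sub insert.prems(2) v x] unfolding W_def .
        define w where "w = x - sc r v"
        have w: "w \<in> W" "w \<in> U" using r W by (auto simp: w_def)
        have xe: "x = sc r v + w" by (simp add: w_def)
        have "B d x = r * B d v + B d w"
          unfolding xe using B dU sv v(1) w(2) subspace(2)[OF sub] by metis
        also have "B d v = L v" using Bd[OF v(1)] Bv by simp
        also have "B d w = L w" using Bd[OF w(2)] orth[OF w(1)] d0 w by simp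
        also have "r * L v + L w = L x"
          unfolding xe using L sv v(1) w(2) by metis
        finally show ?thesis .
      qed
      then show ?thesis using dU by blast
    qed
  qed
qed

text \<open>\<open>Q\<close> is the homogeneous part of degree two of the quadratic functional \<open>J\<close>.\<close>

definition quadratic_on ::
    "(real \<Rightarrow> 'v \<Rightarrow> 'v) \<Rightarrow> 'v::ab_group_add set \<Rightarrow> ('v \<Rightarrow> real) \<Rightarrow> ('v \<Rightarrow> real) \<Rightarrow> bool" where
  "quadratic_on sc U Q J \<longleftrightarrow> (\<exists>B L c. bilinear_form_on sc U B \<and> linear_form_on sc U L \<and>
     (\<forall>x\<in>U. Q x = B x x \<and> J x = B x x + L x + c))"

lemma quadratic_on_cong:
  assumes "quadratic_on sc U Q J" "\<And>x. x \<in> U \<Longrightarrow> Q' x = Q x" "\<And>x. x \<in> U \<Longrightarrow> J' x = J x"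
  shows "quadratic_on sc U Q' J'"
  using assms unfolding quadratic_on_def by simp

lemma quadratic_on_add:
  assumes "quadratic_on sc U Q J" "quadratic_on sc U Q' J'"
  shows "quadratic_on sc U (\<lambda>x. Q x + Q' x) (\<lambda>x. J x + J' x)"
proof -
  obtain B L c where 1: "bilinear_form_on sc U B" "linear_form_on sc U L"
     "\<forall>x\<in>U. Q x = B x x \<and> J x = B x x + L x + c"
    using assms(1) unfolding quadratic_on_def by blast
  obtain B' L' c' where 2: "bilinear_form_on sc U B'" "linear_form_on sc U L'"
     "\<forall>x\<in>U. Q' x = B' x x \<and> J' x = B' x x + L' x + c'"
    using assms(2) unfolding quadratic_on_def by blast
  have "bilinear_form_on sc U (\<lambda>x y. B x y + B' x y)"
    using 1(1) 2(1) unfolding bilinear_form_on_def by (simp add: algebra_simps)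
  moreover have "linear_form_on sc U (\<lambda>x. L x + L' x)"
    using 1(2) 2(2) unfolding linear_form_on_def by (simp add: algebra_simps)
  ultimately show ?thesis
    unfolding quadratic_on_def using 1(3) 2(3)
    by (intro exI[of _ "\<lambda>x y. B x y + B' x y"] exI[of _ "\<lambda>x. L x + L' x"] exI[of _ "c + c'"]) auto
qed

lemma quadratic_on_mult:
  assumes "quadratic_on sc U Q J"
  shows "quadratic_on sc U (\<lambda>x. a * Q x) (\<lambda>x. a * J x)"
proof -
  obtain B L c where 1: "bilinear_form_on sc U B" "linear_form_on sc U L"
     "\<forall>x\<in>U. Q x = B x x \<and> J x = B x x + L x + c"
    using assms(1) unfolding quadratic_on_def by blast
  have "bilinear_form_on sc U (\<lambda>x y. a * B x y)"
    using 1(1) unfolding bilinear_form_on_def by (simp add: algebra_simps)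
  moreover have "linear_form_on sc U (\<lambda>x. a * L x)"
    using 1(2) unfolding linear_form_on_def by (simp add: algebra_simps)
  ultimately show ?thesis
    unfolding quadratic_on_def using 1(3)
    by (intro exI[of _ "\<lambda>x y. a * B x y"] exI[of _ "\<lambda>x. a * L x"] exI[of _ "a * c"])
       (auto simp: algebra_simps)
qed

lemma quadratic_on_zero: "quadratic_on sc U (\<lambda>x. 0) (\<lambda>x. 0)"
  unfolding quadratic_on_def bilinear_form_on_def linear_form_on_def
  by (intro exI[of _ "\<lambda>x y. 0"] exI[of _ "\<lambda>x. 0"] exI[of _ "0"]) auto

lemma quadratic_on_sum:
  assumes "\<And>i. i \<in> A \<Longrightarrow> quadratic_on sc U (Q i) (J i)"
  shows "quadratic_on sc U (\<lambda>x. \<Sum>i\<in>A. Q i x) (\<lambda>x. \<Sum>i\<in>A. J i x)"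
  using assms
  by (induction A rule: infinite_finite_induct) (auto intro: quadratic_on_zero quadratic_on_add)

text \<open>Completing the square. Stationarity of B(x,x) + L(x) reads 2 B(d,x) + L(x) = 0, so
  \<open>d\<close> represents -L/2; then J(x) = J(d) + Q(x - d), and positivity of \<open>Q\<close>
  makes \<open>d\<close> the strict minimizer.\<close>

lemma quadratic_on_unique_minimizer:
  fixes sc :: "real \<Rightarrow> 'v::ab_group_add \<Rightarrow> 'v"
  assumes "vector_space sc" and "finite t"
    and "module.subspace sc U" "U \<subseteq> module.span sc t"
    and J: "quadratic_on sc U Q J"
    and pos: "\<And>x. x \<in> U \<Longrightarrow> x \<noteq> 0 \<Longrightarrow> Q x > 0"
  shows "\<exists>!d. d \<in> U \<and> (\<forall>x\<in>U. J d \<le> J x)"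
proof -
  have m: "module sc" using assms(1) by (simp add: module_iff_vector_space)
  note sub = assms(3) and diff = module.subspace_diff[OF m assms(3)]
  obtain B L c where B: "bilinear_form_on sc U B" and L: "linear_form_on sc U L"
     and QJ: "\<forall>x\<in>U. Q x = B x x \<and> J x = B x x + L x + c"
    using J unfolding quadratic_on_def by blast
  have "linear_form_on sc U (\<lambda>x. - L x / 2)"
    using L unfolding linear_form_on_def by (simp add: field_simps)
  then obtain d where d: "d \<in> U" "\<forall>x\<in>U. B d x = - L x / 2"
    using riesz_finite_dim[OF assms(1-4) B, of "\<lambda>x. - L x / 2"] pos QJ by force
  have J: "J x = J d + Q (x - d)" if x: "x \<in> U" for x
  proof -
    define y where "y = x - d"
    have y: "y \<in> U" using x d by (simp add: y_def diff)
    have xe: "x = y + d" by (simp add: y_def)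
    have "B x x = B y y + 2 * B d y + B d d"
    proof -
      have "B x x = B y x + B d x" "B y x = B x y" "B d x = B x d" "B y d = B d y"
        "B x y = B y y + B d y" "B x d = B y d + B d d"
        using B y d(1) x xe unfolding bilinear_form_on_def by metis+
      then show ?thesis by simp
    qed
    moreover have "L x = L y + L d" unfolding xe using L y d unfolding linear_form_on_def by blast
    ultimately have "J x = J d + B y y" using QJ x d y by simp
    then show ?thesis using QJ y by (simp add: y_def)
  qed
  have Q0: "Q 0 = 0"
    using J[OF d(1)] by simp
  have "J d < J x" if "x \<in> U" "x \<noteq> d" for x
    using J[OF that(1)] pos[of "x - d"] that d diff by simp
  then show ?thesis using d(1) by (metis less_le_not_le nle_le)
qed

lemma integrable_inner_of_squares:
  fixes f g :: "'z \<Rightarrow> 'b::euclidean_space"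
  assumes [measurable]: "f \<in> borel_measurable M" "g \<in> borel_measurable M"
    and "integrable M (\<lambda>z. (norm (f z))\<^sup>2)" "integrable M (\<lambda>z. (norm (g z))\<^sup>2)"
  shows "integrable M (\<lambda>z. f z \<bullet> g z)"
proof (rule Bochner_Integration.integrable_bound)
  show "integrable M (\<lambda>z. (norm (f z))\<^sup>2 + (norm (g z))\<^sup>2)" using assms by simp
  have "\<bar>f z \<bullet> g z\<bar> \<le> (norm (f z))\<^sup>2 + (norm (g z))\<^sup>2" for z
  proof -
    have "\<bar>f z \<bullet> g z\<bar> \<le> norm (f z) * norm (g z)" by (rule Cauchy_Schwarz_ineq2)
    also have "\<dots> \<le> 2 * norm (f z) * norm (g z)" by (simp add: mult_nonneg_nonneg)
    also have "\<dots> \<le> (norm (f z))\<^sup>2 + (norm (g z))\<^sup>2" by (rule sum_squares_bound)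
    finally show ?thesis .
  qed
  then show "AE z in M. norm (f z \<bullet> g z) \<le> norm ((norm (f z))\<^sup>2 + (norm (g z))\<^sup>2)"
    by auto
qed measurable

text \<open>Expanding the square leaves the data \<open>g\<close> only in the linear and the
  constant part, so the homogeneous part is the same integral with \<open>g\<close> replaced by
  0.\<close>

lemma quadratic_on_integral:
  fixes T :: "'v::ab_group_add \<Rightarrow> 'z \<Rightarrow> 'b::euclidean_space"
  assumes U: "\<And>x y. x \<in> U \<Longrightarrow> y \<in> U \<Longrightarrow> x + y \<in> U" "\<And>r x. x \<in> U \<Longrightarrow> sc r x \<in> U"
    and T: "\<And>x. x \<in> U \<Longrightarrow> T x \<in> borel_measurable M"
      "\<And>x. x \<in> U \<Longrightarrow> integrable M (\<lambda>z. (norm (T x z))\<^sup>2)"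
    and g: "g \<in> borel_measurable M" "integrable M (\<lambda>z. (norm (g z))\<^sup>2)"
    and add: "\<And>x y z. x \<in> U \<Longrightarrow> y \<in> U \<Longrightarrow> T (x + y) z = T x z + T y z"
    and scale: "\<And>r x z. x \<in> U \<Longrightarrow> T (sc r x) z = r *\<^sub>R T x z"
  shows "quadratic_on sc U (\<lambda>x. LINT z|M. (norm (T x z))\<^sup>2) (\<lambda>x. LINT z|M. (norm (T x z - g z))\<^sup>2)"
proof -
  note int = integrable_inner_of_squares[OF T(1) T(1) T(2) T(2)]
    integrable_inner_of_squares[OF T(1) g(1) T(2) g(2)]
  have "bilinear_form_on sc U (\<lambda>x y. LINT z|M. T x z \<bullet> T y z)"
    unfolding bilinear_form_on_def
  proof (intro conjI ballI allI)
    fix x y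
    show "(LINT z|M. T x z \<bullet> T y z) = (LINT z|M. T y z \<bullet> T x z)"
      by (simp add: inner_commute)
  qed (use int in \<open>simp_all add: add scale inner_add_left\<close>)
  moreover have "linear_form_on sc U (\<lambda>x. - 2 * (LINT z|M. T x z \<bullet> g z))"
    unfolding linear_form_on_def using int
    by (auto simp: add scale inner_add_left)
  moreover have "(LINT z|M. (norm (T x z - g z))\<^sup>2)
      = (LINT z|M. T x z \<bullet> T x z) + - 2 * (LINT z|M. T x z \<bullet> g z) + (LINT z|M. (norm (g z))\<^sup>2)"
    if x: "x \<in> U" for x
  proof -
    have "(norm (T x z - g z))\<^sup>2 = T x z \<bullet> T x z - 2 * (T x z \<bullet> g z) + (norm (g z))\<^sup>2" for z
      by (simp add: power2_norm_eq_inner inner_diff_left inner_diff_right inner_commute)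
    then show ?thesis using int x g by simp
  qed
  ultimately show ?thesis
    unfolding quadratic_on_def
    by (intro exI[of _ "\<lambda>x y. LINT z|M. T x z \<bullet> T y z"] exI[of _ "\<lambda>x. - 2 * (LINT z|M. T x z \<bullet> g z)"]
          exI[of _ "LINT z|M. (norm (g z))\<^sup>2"]) (auto simp: power2_norm_eq_inner)
qed

subsection \<open>Differential operators on polynomial fields\<close>

lemma poly_fun_if_poly_space:
  assumes "f \<in> poly_space k"
  shows "poly_fun k f"
proof -
  obtain c :: "nat^3 \<Rightarrow> nat \<Rightarrow> real" where c: "\<And>x t. f (x, t) =
     (\<Sum>(\<alpha>, m) \<in> {(\<alpha>, m). (\<Sum>j\<in>UNIV. \<alpha>$j) + m \<le> k}. c \<alpha> m * (\<Prod>j\<in>UNIV. (x$j) ^ (\<alpha>$j)) * t ^ m)"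
    using assms unfolding poly_space_def by blast
  have f: "f = (\<lambda>z. \<Sum>(\<alpha>, m) \<in> {(\<alpha>, m). (\<Sum>j\<in>UNIV. \<alpha>$j) + m \<le> k}.
      c \<alpha> m * (\<Prod>j\<in>UNIV. (fst z$j) ^ (\<alpha>$j)) * snd z ^ m)"
    using c by (auto simp: fun_eq_iff)
  have j: "poly_fun 1 (\<lambda>z :: (real^3) \<times> real. fst z $ j)" for j
    by (rule poly_fun_bounded_linear) (auto intro: linearI)
  have t: "poly_fun 1 (\<lambda>z :: (real^3) \<times> real. snd z)"
    by (rule poly_fun_bounded_linear) (auto intro: linearI)
  have "poly_fun k (\<lambda>z. c \<alpha> m * (\<Prod>j\<in>UNIV. (fst z$j) ^ (\<alpha>$j)) * snd z ^ m)"
    if "(\<Sum>j\<in>UNIV. \<alpha>$j) + m \<le> k" for \<alpha> :: "nat^3" and m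
    using poly_fun_mono[OF poly_fun_mult[OF poly_fun_mult[OF poly_fun.const[of 0 "c \<alpha> m"]
        poly_fun_prod[OF poly_fun_power[OF j]]] poly_fun_power[OF t]]] that by simp
  then show ?thesis
    unfolding f case_prod_beta by (intro poly_fun_sum) auto
qed

lemma poly_fun_vecI:
  fixes v :: "'a::euclidean_space \<Rightarrow> real^'n"
  assumes "\<And>j. poly_fun k (\<lambda>z. v z $ j)"
  shows "poly_fun k v"
proof -
  have "poly_fun k (\<lambda>z. \<Sum>j\<in>UNIV. (v z $ j) *\<^sub>R (axis j 1 :: real^'n))"
    by (intro poly_fun_sum poly_fun_linear[OF _ assms]) (auto intro: linearI simp: scaleR_add_left)
  moreover have "v z = (\<Sum>j\<in>UNIV. (v z $ j) *\<^sub>R (axis j 1 :: real^'n))" for z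
    by (simp add: vec_eq_iff axis_def if_distrib cong: if_cong)
  ultimately show ?thesis by simp
qed

lemma poly_fun_if_div_free_poly: "v \<in> div_free_poly k \<Omega> I \<Longrightarrow> poly_fun k v"
  unfolding div_free_poly_def by (auto intro: poly_fun_vecI poly_fun_if_poly_space)

lemma time_deriv_eq_dir_deriv:
  assumes "poly_fun k v"
  shows "time_deriv v = dir_deriv (0, 1) v"
proof
  fix z :: "(real^3) \<times> real"
  obtain x t where z: "z = (x, t)" by fastforce
  have "((\<lambda>s. v (x, s)) has_derivative (\<lambda>s. dir_deriv (0, s) v z)) (at t)"
    using has_derivative_compose[OF has_derivative_Pair[OF has_derivative_const has_derivative_ident]
        poly_fun_has_derivative[OF assms], of x t UNIV] by (simp add: z)
  moreover have "linear (\<lambda>d. dir_deriv d v z)"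
    using poly_fun_has_derivative[OF assms] has_derivative_linear by blast
  then have "dir_deriv (0, s) v z = s *\<^sub>R dir_deriv (0, 1) v z" for s
    using linear_scale[of "\<lambda>d. dir_deriv d v z" s "(0, 1)"] by simp
  then have "(\<lambda>s. dir_deriv (0, s) v z) = (\<lambda>s. s *\<^sub>R dir_deriv (0, 1) v z)"
    by (rule ext)
  ultimately have "((\<lambda>s. v (x, s)) has_vector_derivative dir_deriv (0, 1) v z) (at t)"
    unfolding has_vector_derivative_def by metis
  then show "time_deriv v z = dir_deriv (0, 1) v z"
    by (simp add: time_deriv_def z vector_derivative_at)
qed

lemma jacobian_eq_dir_deriv:
  fixes v :: vfield
  assumes "poly_fun k v"
  shows "jacobian (\<lambda>y. v (y, t)) (at x) $ i $ j = dir_deriv (axis j 1, 0) v (x, t) $ i"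
proof -
  have "((\<lambda>y. v (y, t)) has_derivative (\<lambda>d. dir_deriv (d, 0) v (x, t))) (at x)"
    using has_derivative_compose[OF has_derivative_Pair[OF has_derivative_ident has_derivative_const]
        poly_fun_has_derivative[OF assms], of t x UNIV] by simp
  then have "frechet_derivative (\<lambda>y. v (y, t)) (at x) = (\<lambda>d. dir_deriv (d, 0) v (x, t))"
    using frechet_derivative_at by metis
  then show ?thesis by (simp add: jacobian_def matrix_def)
qed

lemma divergence_eq_dir_deriv:
  assumes "poly_fun k v"
  shows "divergence v = (\<lambda>z. \<Sum>j\<in>UNIV. dir_deriv (axis j 1, 0) v z $ j)"
  by (auto simp: fun_eq_iff divergence_def trace_def jacobian_eq_dir_deriv[OF assms])

text \<open>Writing the curl as a sum of e_j x d_j v exhibits it as constant linear maps applied to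
  directional derivatives, the form in which polynomiality, additivity and scaling are
  immediate.\<close>

lemma curl_eq_dir_deriv:
  assumes "poly_fun k v"
  shows "curl v = (\<lambda>z. \<Sum>j\<in>UNIV. cross3 (axis j 1) (dir_deriv (axis j 1, 0) v z))"
  by (auto simp: fun_eq_iff curl_def jacobian_eq_dir_deriv[OF assms] vec_eq_iff forall_3 sum_3
      cross3_def axis_def)

lemma linear_cross3: "linear (cross3 a)"
  by (auto intro!: linearI simp: cross_add_right cross_mult_right)

lemma poly_fun_time_deriv: "poly_fun k v \<Longrightarrow> poly_fun k (time_deriv v)"
  by (metis poly_fun_dir_deriv poly_fun_mono diff_le_self time_deriv_eq_dir_deriv)

lemma poly_fun_curl:
  assumes "poly_fun k v"
  shows "poly_fun k (curl v)"
  unfolding curl_eq_dir_deriv[OF assms]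
  by (intro poly_fun_sum poly_fun_linear[OF linear_cross3]
      poly_fun_mono[OF poly_fun_dir_deriv[OF assms]]) simp

lemma poly_fun_divergence:
  assumes "poly_fun k v"
  shows "poly_fun k (divergence v)"
  unfolding divergence_eq_dir_deriv[OF assms]
  by (intro poly_fun_sum poly_fun_linear[OF _ poly_fun_mono[OF poly_fun_dir_deriv[OF assms]]])
     (auto intro: linearI)

lemma
  assumes "poly_fun k v" "poly_fun k w"
  shows time_deriv_add: "time_deriv (v + w) = time_deriv v + time_deriv w"
    and curl_add: "curl (v + w) = curl v + curl w"
    and divergence_add: "divergence (v + w) = divergence v + divergence w"
proof -
  have p: "poly_fun k (v + w)" using poly_fun.add[OF assms] by (simp add: plus_fun_def)
  have d: "dir_deriv e (v + w) z = dir_deriv e v z + dir_deriv e w z" for e z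
    using dir_deriv_add[OF assms, of e] by (simp add: plus_fun_def)
  show "time_deriv (v + w) = time_deriv v + time_deriv w"
    by (auto simp: fun_eq_iff d time_deriv_eq_dir_deriv[OF p] time_deriv_eq_dir_deriv[OF assms(1)]
       time_deriv_eq_dir_deriv[OF assms(2)])
  show "curl (v + w) = curl v + curl w"
    by (auto simp: fun_eq_iff d curl_eq_dir_deriv[OF p] curl_eq_dir_deriv[OF assms(1)]
       curl_eq_dir_deriv[OF assms(2)] cross_add_right sum.distrib)
  show "divergence (v + w) = divergence v + divergence w"
    by (auto simp: fun_eq_iff d divergence_eq_dir_deriv[OF p] divergence_eq_dir_deriv[OF assms(1)]
       divergence_eq_dir_deriv[OF assms(2)] sum.distrib)
qed

lemma
  assumes "poly_fun k v"
  shows time_deriv_scaleR: "time_deriv (\<lambda>z. r *\<^sub>R v z) = (\<lambda>z. r *\<^sub>R time_deriv v z)"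
    and curl_scaleR: "curl (\<lambda>z. r *\<^sub>R v z) = (\<lambda>z. r *\<^sub>R curl v z)"
    and divergence_scaleR: "divergence (\<lambda>z. r *\<^sub>R v z) = (\<lambda>z. r * divergence v z)"
proof -
  have p: "poly_fun k (\<lambda>z. r *\<^sub>R v z)"
    by (rule poly_fun_linear[OF _ assms]) (auto intro: linearI simp: scaleR_add_right)
  have d: "dir_deriv e (\<lambda>z. r *\<^sub>R v z) z = r *\<^sub>R dir_deriv e v z" for e z
    using dir_deriv_linear[OF bounded_linear.linear[OF bounded_linear_scaleR_right] assms, of e r] by simp
  show "time_deriv (\<lambda>z. r *\<^sub>R v z) = (\<lambda>z. r *\<^sub>R time_deriv v z)"
    by (auto simp: fun_eq_iff d time_deriv_eq_dir_deriv[OF p] time_deriv_eq_dir_deriv[OF assms(1)])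
  show "curl (\<lambda>z. r *\<^sub>R v z) = (\<lambda>z. r *\<^sub>R curl v z)"
    by (auto simp: fun_eq_iff d curl_eq_dir_deriv[OF p] curl_eq_dir_deriv[OF assms(1)]
       cross_mult_right scaleR_sum_right)
  show "divergence (\<lambda>z. r *\<^sub>R v z) = (\<lambda>z. r * divergence v z)"
    by (auto simp: fun_eq_iff d divergence_eq_dir_deriv[OF p] divergence_eq_dir_deriv[OF assms(1)]
       sum_distrib_left)
qed

section \<open>Divergence-free polynomial pairs as a subspace of a finite-dimensional space\<close>

lemma poly_space_add: "f \<in> poly_space k \<Longrightarrow> g \<in> poly_space k \<Longrightarrow> (\<lambda>z. f z + g z) \<in> poly_space k"
  unfolding poly_space_def
proof safe
  fix c c' :: "nat^3 \<Rightarrow> nat \<Rightarrow> real"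
  let ?A = "{(\<alpha> :: nat^3, m). (\<Sum>j\<in>UNIV. \<alpha>$j) + m \<le> k}"
  assume "\<forall>x t. f (x, t) = (\<Sum>(\<alpha>, m)\<in>?A. c \<alpha> m * (\<Prod>j\<in>UNIV. (x$j) ^ (\<alpha>$j)) * t ^ m)"
    and "\<forall>x t. g (x, t) = (\<Sum>(\<alpha>, m)\<in>?A. c' \<alpha> m * (\<Prod>j\<in>UNIV. (x$j) ^ (\<alpha>$j)) * t ^ m)"
  then have "\<forall>x t. f (x, t) + g (x, t)
      = (\<Sum>(\<alpha>, m)\<in>?A. (c \<alpha> m + c' \<alpha> m) * (\<Prod>j\<in>UNIV. (x$j) ^ (\<alpha>$j)) * t ^ m)"
    by (simp add: case_prod_beta distrib_right sum.distrib)
  then show "\<exists>c. \<forall>x t. f (x, t) + g (x, t)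
      = (\<Sum>(\<alpha>, m)\<in>?A. c \<alpha> m * (\<Prod>j\<in>UNIV. (x$j) ^ (\<alpha>$j)) * t ^ m)"
    by (rule exI[of _ "\<lambda>\<alpha> m. c \<alpha> m + c' \<alpha> m"])
qed

lemma poly_space_mult: "f \<in> poly_space k \<Longrightarrow> (\<lambda>z. r * f z) \<in> poly_space k"
  unfolding poly_space_def
proof safe
  fix c :: "nat^3 \<Rightarrow> nat \<Rightarrow> real"
  let ?A = "{(\<alpha> :: nat^3, m). (\<Sum>j\<in>UNIV. \<alpha>$j) + m \<le> k}"
  assume "\<forall>x t. f (x, t) = (\<Sum>(\<alpha>, m)\<in>?A. c \<alpha> m * (\<Prod>j\<in>UNIV. (x$j) ^ (\<alpha>$j)) * t ^ m)"
  then have "\<forall>x t. r * f (x, t)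
      = (\<Sum>(\<alpha>, m)\<in>?A. (r * c \<alpha> m) * (\<Prod>j\<in>UNIV. (x$j) ^ (\<alpha>$j)) * t ^ m)"
    by (simp add: case_prod_beta sum_distrib_left mult.assoc)
  then show "\<exists>c. \<forall>x t. r * f (x, t)
      = (\<Sum>(\<alpha>, m)\<in>?A. c \<alpha> m * (\<Prod>j\<in>UNIV. (x$j) ^ (\<alpha>$j)) * t ^ m)"
    by (rule exI[of _ "\<lambda>\<alpha> m. r * c \<alpha> m"])
qed

lemma div_free_poly_add:
  assumes "v \<in> div_free_poly k \<Omega> I" "w \<in> div_free_poly k \<Omega> I"
  shows "v + w \<in> div_free_poly k \<Omega> I"
  using assms divergence_add[OF assms[THEN poly_fun_if_div_free_poly]]
  unfolding div_free_poly_def by (auto intro: poly_space_add)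

lemma div_free_poly_scaleR:
  assumes "v \<in> div_free_poly k \<Omega> I"
  shows "(\<lambda>z. r *\<^sub>R v z) \<in> div_free_poly k \<Omega> I"
  using assms divergence_scaleR[OF assms[THEN poly_fun_if_div_free_poly]]
  unfolding div_free_poly_def by (auto intro: poly_space_mult)

lemma zero_in_div_free_poly: "(\<lambda>z. 0) \<in> div_free_poly k \<Omega> I"
proof -
  have "(\<lambda>z. 0) \<in> poly_space k"
    unfolding poly_space_def by (auto intro!: exI[of _ "\<lambda>_ _. 0"])
  moreover have "divergence (\<lambda>z. 0) = (\<lambda>z. 0)"
    by (simp add: divergence_eq_dir_deriv[OF poly_fun.const[of 0]])
  ultimately show ?thesis unfolding div_free_poly_def by simp
qed

text \<open>Addition on fields is the pointwise one of function types; this supplies the matching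
  scalar multiplication, so that the linear algebra for modules applies to pairs of fields.\<close>

definition pair_scale :: "real \<Rightarrow> vfield \<times> vfield \<Rightarrow> vfield \<times> vfield" where
  "pair_scale r D = (\<lambda>z. r *\<^sub>R fst D z, \<lambda>z. r *\<^sub>R snd D z)"

lemma vector_space_pair_scale: "vector_space pair_scale"
  by unfold_locales (auto simp: pair_scale_def fun_eq_iff scaleR_add_right scaleR_add_left)

lemma subspace_div_free_poly:
  "module.subspace pair_scale (div_free_poly k \<Omega> I \<times> div_free_poly k \<Omega> I)"
proof -
  have m: "module pair_scale" using vector_space_pair_scale by (simp add: module_iff_vector_space)
  show ?thesis
    unfolding module.subspace_def[OF m] using zero_in_div_free_poly[of k \<Omega> I]
    by (auto simp: pair_scale_def zero_prod_def zero_fun_def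
        intro: div_free_poly_add div_free_poly_scaleR)
qed

lemma finite_monomials: "finite {(\<alpha> :: nat^3, m). (\<Sum>j\<in>UNIV. \<alpha>$j) + m \<le> k}"
proof (rule finite_subset)
  show "{(\<alpha> :: nat^3, m). (\<Sum>j\<in>UNIV. \<alpha>$j) + m \<le> k}
      \<subseteq> (vec_lambda ` (PiE UNIV (\<lambda>_ :: 3. {..k}))) \<times> {..k}"
  proof
    fix a assume "a \<in> {(\<alpha> :: nat^3, m). (\<Sum>j\<in>UNIV. \<alpha>$j) + m \<le> k}"
    then obtain \<alpha> m where a: "a = (\<alpha>, m)" and *: "(\<Sum>j\<in>UNIV. \<alpha>$j) + m \<le> k" by blast
    have "\<alpha>$j \<le> k" for j
      using member_le_sum[of j UNIV "\<lambda>j. \<alpha>$j"] * by simp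
    then have "vec_nth \<alpha> \<in> PiE UNIV (\<lambda>_. {..k})" by auto
    then have "\<alpha> \<in> vec_lambda ` (PiE UNIV (\<lambda>_. {..k}))"
      by (metis imageI vec_nth_inverse)
    then show "a \<in> (vec_lambda ` (PiE UNIV (\<lambda>_ :: 3. {..k}))) \<times> {..k}"
      using * a by simp
  qed
  show "finite ((vec_lambda ` (PiE UNIV (\<lambda>_ :: 3. {..k}))) \<times> {..k} :: ((nat^3) \<times> nat) set)"
    by (intro finite_cartesian_product finite_imageI finite_PiE) auto
qed

text \<open>The spanning set consists of monomials placed in a single component of one of the two
  fields. Its members are in general not divergence free, so only an inclusion in the span is
  claimed.\<close>

lemma div_free_poly_finite_dim:
  obtains t where "finite t"
    "div_free_poly k \<Omega> I \<times> div_free_poly k \<Omega> I \<subseteq> module.span pair_scale t"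
proof -
  have m: "module pair_scale" using vector_space_pair_scale by (simp add: module_iff_vector_space)
  define A where "A = {(\<alpha> :: nat^3, m). (\<Sum>j\<in>UNIV. \<alpha>$j) + m \<le> k}"
  define b :: "(nat^3) \<times> nat \<Rightarrow> 3 \<Rightarrow> vfield" where
    "b = (\<lambda>(\<alpha>, m) j z. ((\<Prod>i\<in>UNIV. (fst z$i) ^ (\<alpha>$i)) * snd z ^ m) *\<^sub>R axis j 1)"
  define t where
    "t = (\<lambda>(a, j). (b a j, 0)) ` (A \<times> UNIV) \<union> (\<lambda>(a, j). (0, b a j)) ` (A \<times> UNIV)"
  have "finite A" using finite_monomials by (simp add: A_def)
  then have "finite t" by (simp add: t_def)
  have ex: "\<exists>c. v = (\<Sum>a\<in>A. \<Sum>j\<in>UNIV. (\<lambda>z. c a j *\<^sub>R b a j z))" if v: "v \<in> div_free_poly k \<Omega> I" for v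
  proof -
    have "\<forall>j. \<exists>c :: nat^3 \<Rightarrow> nat \<Rightarrow> real. \<forall>x t. v (x, t) $ j =
       (\<Sum>(\<alpha>, m) \<in> A. c \<alpha> m * (\<Prod>j\<in>UNIV. (x$j) ^ (\<alpha>$j)) * t ^ m)"
      using v unfolding div_free_poly_def poly_space_def A_def by auto
    from choice[OF this] obtain c :: "3 \<Rightarrow> nat^3 \<Rightarrow> nat \<Rightarrow> real" where c: "\<forall>j. \<forall>x t. v (x, t) $ j =
       (\<Sum>(\<alpha>, m) \<in> A. c j \<alpha> m * (\<Prod>j\<in>UNIV. (x$j) ^ (\<alpha>$j)) * t ^ m)" by blast
    have fs: "(\<Sum>i\<in>X. f i) z = (\<Sum>i\<in>X. f i z)" for X and f :: "'x \<Rightarrow> vfield" and z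
      by (induction X rule: infinite_finite_induct) auto
    have inner: "(\<Sum>j\<in>UNIV. c j (fst a) (snd a) *\<^sub>R b a j z) $ i
        = c i (fst a) (snd a) * (\<Prod>i\<in>UNIV. (fst z$i) ^ (fst a$i)) * snd z ^ snd a" for a z i
      by (simp add: b_def case_prod_beta axis_def if_distrib cong: if_cong)
    have "v z $ i = (\<Sum>a\<in>A. \<Sum>j\<in>UNIV. (\<lambda>z. c j (fst a) (snd a) *\<^sub>R b a j z)) z $ i" for z i
    proof -
      have "v z $ i = (\<Sum>a\<in>A. c i (fst a) (snd a) * (\<Prod>i\<in>UNIV. (fst z$i) ^ (fst a$i)) * snd z ^ snd a)"
        using c[rule_format, of "fst z" "snd z" i] by (simp add: case_prod_beta)
      also have "\<dots> = (\<Sum>a\<in>A. (\<Sum>j\<in>UNIV. c j (fst a) (snd a) *\<^sub>R b a j z) $ i)"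
        by (simp only: inner)
      finally show ?thesis by (simp only: fs sum_component)
    qed
    then have "v = (\<Sum>a\<in>A. \<Sum>j\<in>UNIV. (\<lambda>z. c j (fst a) (snd a) *\<^sub>R b a j z))"
      unfolding fun_eq_iff vec_eq_iff by blast
    then show ?thesis by (rule exI[of _ "\<lambda>a j. c j (fst a) (snd a)"])
  qed
  have "D \<in> module.span pair_scale t" if D: "D \<in> div_free_poly k \<Omega> I \<times> div_free_poly k \<Omega> I" for D
  proof -
    obtain c where c: "fst D = (\<Sum>a\<in>A. \<Sum>j\<in>UNIV. (\<lambda>z. c a j *\<^sub>R b a j z))" using ex D by force
    obtain d where d: "snd D = (\<Sum>a\<in>A. \<Sum>j\<in>UNIV. (\<lambda>z. d a j *\<^sub>R b a j z))" using ex D by force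
    have "D = (\<Sum>a\<in>A. \<Sum>j\<in>UNIV. pair_scale (c a j) (b a j, 0) + pair_scale (d a j) (0, b a j))"
    proof -
      have "pair_scale r (v, 0) = (\<lambda>z. r *\<^sub>R v z, 0)" "pair_scale r (0, v) = (0, \<lambda>z. r *\<^sub>R v z)" for r v
        by (simp_all add: pair_scale_def zero_fun_def)
      then show ?thesis by (simp add: prod_eq_iff c d fst_sum snd_sum)
    qed
    also have "\<dots> \<in> module.span pair_scale t"
      by (intro module.span_sum[OF m] module.span_add[OF m] module.span_scale[OF m] module.span_base[OF m])
         (auto simp: t_def)
    finally show ?thesis .
  qed
  then show ?thesis using that \<open>finite t\<close> by blast
qed

subsection \<open>Space-time integrals\<close>

lemma poly_fun_eq_0_if_AE_interval:
  fixes v :: "real \<Rightarrow> 'b::euclidean_space"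
  assumes v: "poly_fun k v" and ab: "a < b" and ae: "AE t in lborel. t \<in> {a..b} \<longrightarrow> v t = 0"
  shows "v t = 0"
proof (rule euclidean_eqI)
  fix i :: 'b assume "i \<in> Basis"
  have p: "poly_fun k (\<lambda>t. v t \<bullet> i)"
    by (rule poly_fun_linear[OF _ v]) (auto intro: linearI simp: inner_add_left)
  show "v t \<bullet> i = 0 \<bullet> i"
  proof (rule ccontr)
    assume "v t \<bullet> i \<noteq> 0 \<bullet> i"
    then have "finite {t. v t \<bullet> i = 0}" using poly_fun_real_zero[OF p, of t] by auto
    then have "AE t in lborel. t \<notin> {t. v t \<bullet> i = 0}"
      by (intro AE_not_in finite_imp_null_set_lborel)
    with ae have "AE t in lborel. t \<notin> {a..b}" by eventually_elim auto
    then have "{a..b} \<in> null_sets lborel" by (subst AE_iff_null_sets) auto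
    then show False using ab by (simp add: null_sets_def)
  qed
qed

text \<open>The points of the interior where a component is non-zero form an open null set, which
  must be empty.\<close>

lemma poly_fun_eq_0_if_AE_box:
  fixes v :: "'a::euclidean_space \<Rightarrow> 'b::euclidean_space"
  assumes v: "poly_fun k v" and S: "interior S \<noteq> {}" and ae: "AE x in lborel. x \<in> S \<longrightarrow> v x = 0"
  shows "v x = 0"
proof (rule euclidean_eqI)
  fix i :: 'b assume "i \<in> Basis"
  have p: "poly_fun k (\<lambda>x. v x \<bullet> i)"
    by (rule poly_fun_linear[OF _ v]) (auto intro: linearI simp: inner_add_left)
  define N where "N = interior S \<inter> {x. v x \<bullet> i \<noteq> 0}"
  have oN: "open N" unfolding N_def
    by (intro open_Int open_interior open_Collect_neq poly_fun_continuous[OF p]) auto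
  have "AE x in lborel. x \<notin> N"
    using ae by eventually_elim (use interior_subset in \<open>auto simp: N_def\<close>)
  then have "N \<in> null_sets lborel" using oN by (subst AE_iff_null_sets) auto
  then have "negligible N" using negligible_iff_null_sets null_sets_completionI by blast
  then have "N = {}" using oN open_not_negligible by blast
  then have "v x \<bullet> i = 0" if "x \<in> interior S" for x
    using that by (auto simp: N_def)
  then show "v x \<bullet> i = 0 \<bullet> i"
    using poly_fun_eq_0_if_interior[OF p, of "interior S"] S by simp
qed

definition st_measure :: "(real^3) measure \<Rightarrow> (real^3) set \<Rightarrow> real set \<Rightarrow> ((real^3) \<times> real) measure" where
  "st_measure M A I = restrict_space M A \<Otimes>\<^sub>M restrict_space lborel I"

definition L2_field ::
  "(real^3) measure \<Rightarrow> (real^3) set \<Rightarrow> real set \<Rightarrow> ((real^3) \<times> real \<Rightarrow> 'b::real_inner) \<Rightarrow> bool" where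
  "L2_field M A I v \<longleftrightarrow> v \<in> borel_measurable (st_measure M A I) \<and>
     integrable (st_measure M A I) (\<lambda>z. (norm (v z))\<^sup>2)"

lemma L2_field_bounded_linear:
  fixes L :: "'b::euclidean_space \<Rightarrow> 'c::euclidean_space"
  assumes bl: "bounded_linear L" and v: "L2_field M A I v"
  shows "L2_field M A I (\<lambda>z. L (v z))"
proof -
  have [measurable]: "v \<in> borel_measurable (st_measure M A I)" using v by (simp add: L2_field_def)
  have [measurable]: "L \<in> borel_measurable borel"
    using bl by (intro borel_measurable_continuous_onI linear_continuous_on)
  obtain B where B: "\<And>x. norm (L x) \<le> norm x * B" using bounded_linear.bounded[OF bl] by blast
  have "integrable (st_measure M A I) (\<lambda>z. (norm (L (v z)))\<^sup>2)"
  proof (rule Bochner_Integration.integrable_bound)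
    show "integrable (st_measure M A I) (\<lambda>z. B\<^sup>2 * (norm (v z))\<^sup>2)"
      using v by (simp add: L2_field_def)
    have "(norm (L (v z)))\<^sup>2 \<le> B\<^sup>2 * (norm (v z))\<^sup>2" for z
      using power_mono[OF B norm_ge_zero, of "v z" 2] by (simp add: power_mult_distrib mult.commute)
    then show "AE z in st_measure M A I. norm ((norm (L (v z)))\<^sup>2) \<le> norm (B\<^sup>2 * (norm (v z))\<^sup>2)"
      by auto
  qed measurable
  then show ?thesis by (simp add: L2_field_def)
qed

text \<open>Common setting for the patch with Lebesgue measure and for the boundary and the
  interfaces with surface measure. Finite measure yields Fubini and makes bounded fields square
  integrable.\<close>

locale spacetime_domain =
  fixes M :: "(real^3) measure" and A :: "(real^3) set" and a b :: real
  assumes sets_M: "sets M = sets borel" and A: "A \<in> sets borel"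
    and finite_A: "emeasure M A < \<infinity>" and ab: "a < b"
begin

lemma space_M: "space M = UNIV"
  using sets_eq_imp_space_eq[OF sets_M] by simp

lemma finite_space: "finite_measure (restrict_space M A)"
  using A finite_A
  by (intro finite_measureI) (simp add: space_restrict_space space_M sets_M emeasure_restrict_space)

lemma finite_time: "finite_measure (restrict_space lborel {a..b})"
  using ab by (intro finite_measureI) (simp add: space_restrict_space emeasure_restrict_space)

lemma sigma_finite_pair: "pair_sigma_finite (restrict_space M A) (restrict_space lborel {a..b})"
  by (intro pair_sigma_finite.intro finite_measure.axioms(1) finite_space finite_time)

lemma finite_st_measure: "finite_measure (st_measure M A {a..b})"
  unfolding st_measure_def by (rule finite_measure_pair_measure[OF finite_time finite_space])

lemma AE_space_iff: "(AE x in restrict_space M A. P x) \<longleftrightarrow> (AE x in M. x \<in> A \<longrightarrow> P x)"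
  using A by (intro AE_restrict_space_iff) (simp add: sets_M space_M)

lemma AE_time_iff: "(AE t in restrict_space lborel {a..b}. P t) \<longleftrightarrow> (AE t in lborel. t \<in> {a..b} \<longrightarrow> P t)"
  by (intro AE_restrict_space_iff) simp

text \<open>The inner products are iterated integrals; integrability on the product allows Fubini,
  after which the expansion of squares works with a single integral.\<close>

lemma st_inner_eq_integral:
  fixes v w :: "(real^3) \<times> real \<Rightarrow> 'b::real_inner"
  assumes "integrable (st_measure M A {a..b}) (\<lambda>z. v z \<bullet> w z)"
  shows "st_inner M A {a..b} v w = (LINT z|st_measure M A {a..b}. v z \<bullet> w z)"
proof -
  have "(LINT z|st_measure M A {a..b}. v z \<bullet> w z)
      = (LINT t|restrict_space lborel {a..b}. LINT x|restrict_space M A. v (x, t) \<bullet> w (x, t))"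
    using pair_sigma_finite.integral_snd[OF sigma_finite_pair, of "\<lambda>x t. v (x, t) \<bullet> w (x, t)"] assms
    unfolding st_measure_def by (simp add: case_prod_beta')
  also have "\<dots> = st_inner M A {a..b} v w"
    unfolding st_inner_def set_lebesgue_integral_def
    using A by (simp add: integral_restrict_space sets_M space_M)
  finally show ?thesis by simp
qed

lemma fst_measurable: "fst \<in> st_measure M A {a..b} \<rightarrow>\<^sub>M restrict_space M A"
  unfolding st_measure_def by (rule measurable_fst)

lemma continuous_measurable:
  fixes v :: "(real^3) \<times> real \<Rightarrow> 'b::euclidean_space"
  assumes "continuous_on UNIV v"
  shows "v \<in> borel_measurable (st_measure M A {a..b})"
proof -
  have "fst \<in> borel_measurable (st_measure M A {a..b})"
    by (rule measurable_compose[OF fst_measurable measurable_restrict_space1[OF measurable_ident_sets[OF sets_M]]])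
  moreover have "snd \<in> borel_measurable (st_measure M A {a..b})"
    unfolding st_measure_def
    by (rule measurable_compose[OF measurable_snd measurable_restrict_space1[OF measurable_ident_sets]]) simp
  ultimately have "(\<lambda>z. (fst z, snd z)) \<in> borel_measurable (st_measure M A {a..b})"
    by (rule borel_measurable_Pair)
  from measurable_compose[OF this borel_measurable_continuous_onI[OF assms]] show ?thesis by simp
qed

text \<open>The bound is required only for almost every point of space because the boundary normal
  has length one only almost everywhere.\<close>

lemma L2_field_bounded:
  fixes v :: "(real^3) \<times> real \<Rightarrow> 'b::euclidean_space"
  assumes v: "v \<in> borel_measurable (st_measure M A {a..b})"
    and ae: "AE x in M. x \<in> A \<longrightarrow> (\<forall>t\<in>{a..b}. norm (v (x, t)) \<le> C)"
  shows "L2_field M A {a..b} v"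
proof -
  have [measurable]: "v \<in> borel_measurable (restrict_space M A \<Otimes>\<^sub>M restrict_space lborel {a..b})"
    using v by (simp add: st_measure_def)
  have "AE x in restrict_space M A. AE t in restrict_space lborel {a..b}. norm (v (x, t)) \<le> C"
    unfolding AE_space_iff AE_time_iff using ae by eventually_elim auto
  moreover have "{z \<in> space (restrict_space M A \<Otimes>\<^sub>M restrict_space lborel {a..b}). norm (v z) \<le> C}
      \<in> sets (restrict_space M A \<Otimes>\<^sub>M restrict_space lborel {a..b})"
    by measurable
  ultimately have "AE z in st_measure M A {a..b}. norm (v z) \<le> C"
    unfolding st_measure_def by (intro pair_sigma_finite.AE_pair_measure[OF sigma_finite_pair])
  then have "AE z in st_measure M A {a..b}. norm ((norm (v z))\<^sup>2) \<le> C\<^sup>2"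
    by eventually_elim (simp add: power_mono)
  then have "integrable (st_measure M A {a..b}) (\<lambda>z. (norm (v z))\<^sup>2)"
    using v by (intro finite_measure.integrable_const_bound[OF finite_st_measure]) auto
  then show ?thesis using v by (simp add: L2_field_def)
qed

lemma bounded_field:
  fixes v :: "(real^3) \<times> real \<Rightarrow> 'b::euclidean_space"
  assumes "continuous_on UNIV v" and "bounded A"
  obtains C where "\<And>x t. x \<in> A \<Longrightarrow> t \<in> {a..b} \<Longrightarrow> norm (v (x, t)) \<le> C"
proof -
  have "compact (v ` (closure A \<times> {a..b}))"
    using assms by (intro compact_continuous_image compact_Times)
      (auto intro: continuous_on_subset simp: compact_closure)
  then obtain C where C: "\<forall>y\<in>v ` (closure A \<times> {a..b}). norm y \<le> C"
    using compact_imp_bounded bounded_iff by metis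
  have "norm (v (x, t)) \<le> C" if "x \<in> A" "t \<in> {a..b}" for x t
    using C that closure_subset[of A] by blast
  then show ?thesis using that by blast
qed

lemma L2_field_continuous:
  fixes v :: "(real^3) \<times> real \<Rightarrow> 'b::euclidean_space"
  assumes "continuous_on UNIV v" and "bounded A"
  shows "L2_field M A {a..b} v"
proof -
  obtain C where "\<And>x t. x \<in> A \<Longrightarrow> t \<in> {a..b} \<Longrightarrow> norm (v (x, t)) \<le> C"
    using bounded_field[OF assms] by blast
  then show ?thesis
    using continuous_measurable[OF assms(1)] by (intro L2_field_bounded[of v C]) auto
qed

lemma quadratic_on_st_inner:
  fixes F :: "'v::ab_group_add \<Rightarrow> (real^3) \<times> real \<Rightarrow> 'b::euclidean_space"
  assumes U: "\<And>x y. x \<in> U \<Longrightarrow> y \<in> U \<Longrightarrow> x + y \<in> U" "\<And>r x. x \<in> U \<Longrightarrow> sc r x \<in> U"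
    and F: "\<And>x. x \<in> U \<Longrightarrow> L2_field M A {a..b} (F x)" and g: "L2_field M A {a..b} g"
    and add: "\<And>x y z. x \<in> U \<Longrightarrow> y \<in> U \<Longrightarrow> F (x + y) z = F x z + F y z"
    and scale: "\<And>r x z. x \<in> U \<Longrightarrow> F (sc r x) z = r *\<^sub>R F x z"
  shows "quadratic_on sc U (\<lambda>x. st_inner M A {a..b} (F x) (F x))
     (\<lambda>x. st_inner M A {a..b} (\<lambda>z. F x z - g z) (\<lambda>z. F x z - g z))"
proof -
  let ?P = "st_measure M A {a..b}"
  note int = F[unfolded L2_field_def] g[unfolded L2_field_def]
  have "quadratic_on sc U (\<lambda>x. LINT z|?P. (norm (F x z))\<^sup>2) (\<lambda>x. LINT z|?P. (norm (F x z - g z))\<^sup>2)"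
    by (rule quadratic_on_integral) (use U int add scale in auto)
  moreover have "st_inner M A {a..b} (F x) (F x) = (LINT z|?P. (norm (F x z))\<^sup>2)" if "x \<in> U" for x
    using st_inner_eq_integral[of "F x" "F x"] int(1)[OF that] by (simp add: power2_norm_eq_inner)
  moreover have "st_inner M A {a..b} (\<lambda>z. F x z - g z) (\<lambda>z. F x z - g z)
      = (LINT z|?P. (norm (F x z - g z))\<^sup>2)" if "x \<in> U" for x
  proof -
    have "integrable ?P (\<lambda>z. F x z \<bullet> g z)"
      using int(1)[OF that] int(2) by (intro integrable_inner_of_squares) auto
    then have "integrable ?P (\<lambda>z. (norm (F x z))\<^sup>2 - 2 * (F x z \<bullet> g z) + (norm (g z))\<^sup>2)"
      using int(1)[OF that] int(2) by simp
    also have "(\<lambda>z. (norm (F x z))\<^sup>2 - 2 * (F x z \<bullet> g z) + (norm (g z))\<^sup>2)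
        = (\<lambda>z. (F x z - g z) \<bullet> (F x z - g z))"
      by (auto simp: fun_eq_iff power2_norm_eq_inner inner_diff_left inner_diff_right inner_commute)
    finally show ?thesis using st_inner_eq_integral by (simp add: power2_norm_eq_inner)
  qed
  ultimately show ?thesis by (rule quadratic_on_cong)
qed

lemma st_inner_eq_0_AE:
  fixes v :: "(real^3) \<times> real \<Rightarrow> 'b::euclidean_space"
  assumes v: "L2_field M A {a..b} v" and 0: "st_inner M A {a..b} v v = 0"
  shows "AE x in M. x \<in> A \<longrightarrow> (AE t in lborel. t \<in> {a..b} \<longrightarrow> v (x, t) = 0)"
proof -
  have int: "integrable (st_measure M A {a..b}) (\<lambda>z. v z \<bullet> v z)"
    using v by (simp add: L2_field_def power2_norm_eq_inner)
  then have "AE z in st_measure M A {a..b}. v z \<bullet> v z = 0"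
    using 0 st_inner_eq_integral[OF int] integral_nonneg_eq_0_iff_AE[OF int] by simp
  then have "AE z in restrict_space M A \<Otimes>\<^sub>M restrict_space lborel {a..b}. v z = 0"
    unfolding st_measure_def by simp
  then have "AE x in restrict_space M A. AE t in restrict_space lborel {a..b}. v (x, t) = 0"
    by (rule pair_sigma_finite.AE_pair[OF sigma_finite_pair])
  then show ?thesis unfolding AE_space_iff AE_time_iff .
qed

text \<open>For almost every x the field is a polynomial in t that vanishes almost everywhere on a
  nondegenerate interval, hence for all times. The exceptional set of points x is therefore the same
  for all t.\<close>

lemma st_inner_poly_eq_0_AE:
  fixes v :: "(real^3) \<times> real \<Rightarrow> 'b::euclidean_space"
  assumes v: "poly_fun k v" and "bounded A" and 0: "st_inner M A {a..b} v v = 0"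
  shows "AE x in M. x \<in> A \<longrightarrow> (\<forall>t. v (x, t) = 0)"
proof -
  have p: "poly_fun k (\<lambda>t. v (x, t))" for x
    using poly_fun_line[OF v, of "(x, 0)" "(0, 1)"] by simp
  have "AE x in M. x \<in> A \<longrightarrow> (AE t in lborel. t \<in> {a..b} \<longrightarrow> v (x, t) = 0)"
    by (rule st_inner_eq_0_AE[OF L2_field_continuous[OF poly_fun_continuous[OF v] assms(2)] 0])
  then show ?thesis
    by (rule eventually_mono) (use poly_fun_eq_0_if_AE_interval[OF p ab] in blast)
qed

end

section \<open>The patch, the interfaces and the embedded boundary as integration domains\<close>

lemma poly_fun_slice:
  fixes v :: "'a::euclidean_space \<times> 'c::euclidean_space \<Rightarrow> 'b::real_normed_vector"
  assumes "poly_fun k v"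
  shows "poly_fun k (\<lambda>x. v (x, t))"
proof -
  have "linear (\<lambda>x :: 'a. (x, 0 :: 'c))" by (auto intro: linearI)
  from poly_fun_compose_affine[OF this assms, of "(0, t)"] show ?thesis by simp
qed

lemma fictitious_interface_bounded:
  assumes "fictitious_interface \<Omega>p \<Omega> S \<nu>" "bounded \<Omega>"
  shows "bounded S" "S \<in> sets borel" "\<Omega> \<inter> S = S" "norm \<nu> = 1" "emeasure surface_measure S > 0"
    "emeasure surface_measure S < \<infinity>" "\<exists>d. \<forall>x\<in>S. \<nu> \<bullet> x = d"
  using assms emeasure_surface_measure_planar_finite[of \<nu> S] bounded_subset[of \<Omega> S]
  unfolding fictitious_interface_def by auto

lemma fictitious_interface_domain:
  assumes "fictitious_interface \<Omega>p \<Omega> S \<nu>" "bounded \<Omega>" "a < b"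
  shows "spacetime_domain surface_measure (\<Omega> \<inter> S) a b"
  using assms fictitious_interface_bounded[OF assms(1,2)] by unfold_locales simp_all

text \<open>Since one exceptional set serves all times, the planar identity theorem can be applied
  at each fixed t and to each component; the plane, given by \<open>d\<close>, does not depend on
  t.\<close>

lemma fictitious_interface_poly_zero:
  fixes v :: "(real^3) \<times> real \<Rightarrow> 'b::euclidean_space"
  assumes S: "fictitious_interface \<Omega>p \<Omega> S \<nu>" and \<Omega>: "bounded \<Omega>" and ab: "a < b"
    and v: "poly_fun k v" and 0: "surface_sq \<Omega> {a..b} S v = 0"
  obtains d where "\<And>x t. \<nu> \<bullet> x = d \<Longrightarrow> v (x, t) = 0"
proof -
  note S' = fictitious_interface_bounded[OF S \<Omega>]
  obtain d where d: "\<forall>x\<in>S. \<nu> \<bullet> x = d" using S' by blast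
  note dom = fictitious_interface_domain[OF S \<Omega> ab]
  have ae: "AE x in surface_measure. x \<in> S \<longrightarrow> (\<forall>t. v (x, t) = 0)"
    using spacetime_domain.st_inner_poly_eq_0_AE[OF dom v] 0 S' by (simp add: surface_sq_def)
  have "v (x, t) = 0" if x: "\<nu> \<bullet> x = d" for x t
  proof (rule euclidean_eqI)
    fix i :: 'b assume "i \<in> Basis"
    have "poly_fun k (\<lambda>x. v (x, t) \<bullet> i)"
      by (rule poly_fun_linear[OF _ poly_fun_slice[OF v]]) (auto intro: linearI simp: inner_add_left)
    moreover have "AE x in surface_measure. x \<in> S \<longrightarrow> v (x, t) \<bullet> i = 0"
      using ae by eventually_elim auto
    ultimately show "v (x, t) \<bullet> i = 0 \<bullet> i"
      using poly_fun_eq_0_if_planar_AE[OF _ S'(4) d S'(1,2,5) _ x] by simp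
  qed
  then show ?thesis using that by blast
qed

lemma patch_domain:
  assumes "l > 0" "a < b"
  shows "spacetime_domain lborel (local_patch p l) a b"
  using assms unfolding local_patch_def
  by unfold_locales (auto simp: emeasure_lborel_cbox_eq)

lemma interior_local_patch: "l > 0 \<Longrightarrow> interior (local_patch p l) \<noteq> {}"
  unfolding local_patch_def interior_cbox
  by (auto simp: box_ne_empty Basis_vec_def inner_axis)

lemma patch_poly_zero:
  fixes v :: "(real^3) \<times> real \<Rightarrow> 'b::euclidean_space"
  assumes "l > 0" "a < b" and v: "poly_fun k v" and 0: "patch_sq (local_patch p l) {a..b} v = 0"
  shows "v z = 0"
proof -
  have "bounded (local_patch p l)" by (simp add: local_patch_def)
  then have "AE x in lborel. x \<in> local_patch p l \<longrightarrow> (\<forall>t. v (x, t) = 0)"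
    using spacetime_domain.st_inner_poly_eq_0_AE[OF patch_domain[OF assms(1,2)] v] 0 by (simp add: patch_sq_def)
  then have "AE x in lborel. x \<in> local_patch p l \<longrightarrow> v (x, snd z) = 0" by eventually_elim auto
  from poly_fun_eq_0_if_AE_box[OF poly_fun_slice[OF v] interior_local_patch[OF assms(1)] this, of "fst z"]
  show ?thesis by simp
qed

text \<open>The space prescribes this on the patch and the time interval only; the divergence is
  itself a polynomial, so it vanishes throughout space-time, where the evolution argument takes
  place.\<close>

lemma div_free_poly_divergence:
  assumes "v \<in> div_free_poly k (local_patch p l) {a..b}" "l > 0" "a < b"
  shows "divergence v z = 0"
proof (rule poly_fun_eq_0_if_interior[of k "divergence v" "local_patch p l \<times> {a..b}"])
  show "poly_fun k (divergence v)"
    using assms(1) by (intro poly_fun_divergence poly_fun_if_div_free_poly)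
  show "interior (local_patch p l \<times> {a..b}) \<noteq> {}"
    using interior_local_patch[OF assms(2), of p] assms(3) by (simp add: interior_Times)
  fix w assume "w \<in> local_patch p l \<times> {a..b}"
  then show "divergence v w = 0"
    using assms(1) unfolding div_free_poly_def by blast
qed

lemma embedded_boundary_domain:
  assumes \<Gamma>: "embedded_boundary \<Omega>m \<Omega>p \<Gamma> n" and \<Omega>: "compact \<Omega>" and ab: "a < b"
  shows "spacetime_domain surface_measure (\<Omega> \<inter> \<Gamma>) a b"
proof
  have "closed \<Gamma>" using \<Gamma> by (auto simp: embedded_boundary_def)
  then show "\<Omega> \<inter> \<Gamma> \<in> sets borel" using \<Omega> by (auto intro: borel_closed compact_imp_closed)
  show "emeasure surface_measure (\<Omega> \<inter> \<Gamma>) < \<infinity>"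
    using \<Gamma> \<Omega> unfolding embedded_boundary_def by (metis Int_commute)
qed (use ab in simp_all)

lemma norm_cross3_le: "norm (cross3 x y) \<le> norm x * norm y"
proof -
  have "(norm (cross3 x y))\<^sup>2 \<le> (norm x * norm y)\<^sup>2"
    using norm_cross[of x y] by (simp add: power_mult_distrib)
  then show ?thesis by (rule power2_le_imp_le) simp
qed

lemma bounded_linear_cross3: "bounded_linear (cross3 x)"
  by (rule bounded_linear_intro[of _ "norm x"])
     (simp_all add: cross_add_right cross_mult_right norm_cross3_le mult.commute[of "norm _" "norm x"])

text \<open>\<open>h\<close> stands for the cross product and for the inner product. As the normal
  has length one almost everywhere, the estimate on \<open>h\<close> reduces the claim to
  boundedness of the polynomial on a compact set.\<close>

lemma L2_field_normal:
  fixes h :: "real^3 \<Rightarrow> real^3 \<Rightarrow> 'b::euclidean_space"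
  assumes \<Gamma>: "embedded_boundary \<Omega>m \<Omega>p \<Gamma> n" and \<Omega>: "compact \<Omega>" and ab: "a < b"
    and v: "poly_fun k v" and h: "continuous_on UNIV (\<lambda>(x, y). h x y)"
      "\<And>x y. norm (h x y) \<le> norm x * norm y"
  shows "L2_field surface_measure (\<Omega> \<inter> \<Gamma>) {a..b} (\<lambda>(x, t). h (n x) (v (x, t)))"
proof -
  note dom = embedded_boundary_domain[OF \<Gamma> \<Omega> ab]
  let ?P = "st_measure surface_measure (\<Omega> \<inter> \<Gamma>) {a..b}"
  have cv: "continuous_on UNIV v" using poly_fun_continuous[OF v] .
  have "n \<in> borel_measurable (restrict_space surface_measure \<Gamma>)"
    using \<Gamma> by (simp add: embedded_boundary_def cong: measurable_cong_sets sets_restrict_space_cong)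
  then have "n \<in> borel_measurable (restrict_space surface_measure (\<Omega> \<inter> \<Gamma>))"
    by (rule measurable_restrict_mono) simp
  from measurable_compose[OF spacetime_domain.fst_measurable[OF dom] this]
  have "(\<lambda>z. n (fst z)) \<in> borel_measurable ?P" .
  from borel_measurable_Pair[OF this spacetime_domain.continuous_measurable[OF dom cv]]
  have "(\<lambda>z. (n (fst z), v z)) \<in> borel_measurable ?P" .
  from measurable_compose[OF this borel_measurable_continuous_onI[OF h(1)]]
  have m: "(\<lambda>(x, t). h (n x) (v (x, t))) \<in> borel_measurable ?P"
    by (simp add: case_prod_beta')
  have "bounded (\<Omega> \<inter> \<Gamma>)" using \<Omega> by (simp add: bounded_Int compact_imp_bounded)
  then obtain C where C: "\<And>x t. x \<in> \<Omega> \<inter> \<Gamma> \<Longrightarrow> t \<in> {a..b} \<Longrightarrow> norm (v (x, t)) \<le> C"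
    using spacetime_domain.bounded_field[OF dom cv] by blast
  have "AE x in surface_measure. x \<in> \<Gamma> \<longrightarrow> norm (n x) = 1"
    using \<Gamma> unfolding embedded_boundary_def by (blast intro: eventually_mono)
  then have "AE x in surface_measure. x \<in> \<Omega> \<inter> \<Gamma> \<longrightarrow>
      (\<forall>t\<in>{a..b}. norm (case (x, t) of (x, t) \<Rightarrow> h (n x) (v (x, t))) \<le> C)"
  proof eventually_elim
    case (elim x)
    show ?case
    proof (intro impI ballI)
      fix t assume *: "x \<in> \<Omega> \<inter> \<Gamma>" "t \<in> {a..b}"
      then have "norm (h (n x) (v (x, t))) \<le> norm (v (x, t))" using h(2)[of "n x" "v (x, t)"] elim by simp
      then show "norm (case (x, t) of (x, t) \<Rightarrow> h (n x) (v (x, t))) \<le> C" using C[OF *] by simp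
    qed
  qed
  then show ?thesis by (rule spacetime_domain.L2_field_bounded[OF dom m])
qed

lemma quadratic_on_interface:
  fixes L :: "real^3 \<Rightarrow> 'b::euclidean_space" and F :: "'v::ab_group_add \<Rightarrow> vfield"
  assumes S: "fictitious_interface \<Omega>p \<Omega> S \<nu>" and \<Omega>: "bounded \<Omega>" and ab: "a < b"
    and bl: "bounded_linear L" and G: "square_integrable_field S {a..b} G"
    and U: "\<And>x y. x \<in> U \<Longrightarrow> y \<in> U \<Longrightarrow> x + y \<in> U" "\<And>r x. x \<in> U \<Longrightarrow> sc r x \<in> U"
    and F: "\<And>x. x \<in> U \<Longrightarrow> poly_fun k (F x)"
    and add: "\<And>x y z. F (x + y) z = F x z + F y z"
    and scale: "\<And>r x z. F (sc r x) z = r *\<^sub>R F x z"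
  shows "quadratic_on sc U (\<lambda>x. surface_sq \<Omega> {a..b} S (\<lambda>z. L (F x z)))
     (\<lambda>x. surface_sq \<Omega> {a..b} S (\<lambda>z. L (F x z - G z)))"
proof -
  note L = bounded_linear.linear[OF bl]
  note S' = fictitious_interface_bounded[OF S \<Omega>]
  note dom = fictitious_interface_domain[OF S \<Omega> ab]
  have "L2_field surface_measure (\<Omega> \<inter> S) {a..b} G"
    using G S' by (simp add: square_integrable_field_def L2_field_def st_measure_def Let_def)
  from L2_field_bounded_linear[OF bl this]
  have "L2_field surface_measure (\<Omega> \<inter> S) {a..b} (\<lambda>z. L (G z))" .
  moreover have "L2_field surface_measure (\<Omega> \<inter> S) {a..b} (\<lambda>z. L (F x z))" if "x \<in> U" for x
    using S' by (intro spacetime_domain.L2_field_continuous[OF dom] poly_fun_continuous[OF poly_fun_linear[OF L F[OF that]]]) simp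
  ultimately show ?thesis
    unfolding surface_sq_def linear_diff[OF L]
    by (intro spacetime_domain.quadratic_on_st_inner[OF dom] U) (auto simp: add scale linear_add[OF L] linear_scale[OF L])
qed

text \<open>Both normals are multiples of the first axis. The cross product then kills components 2
  and 3 on the plane of \<open>S\<close>, the inner product kills component 1 on the plane of
  \<open>S'\<close>; these planes may differ, so \<open>s\<close> depends on
  \<open>j\<close>.\<close>

lemma interfaces_zero_on_planes:
  fixes v :: vfield
  assumes S: "fictitious_interface \<Omega>p \<Omega> S \<nu>" "fictitious_interface \<Omega>p \<Omega> S' \<nu>'"
    and par: "parallel_to_coord_plane \<nu> 1" "parallel_to_coord_plane \<nu>' 1"
    and \<Omega>: "bounded \<Omega>" and ab: "a < b" and v: "poly_fun k v"
    and tang: "surface_sq \<Omega> {a..b} S (\<lambda>z. cross3 \<nu> (v z)) = 0"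
    and norm: "surface_sq \<Omega> {a..b} S' (\<lambda>z. \<nu>' \<bullet> v z) = 0"
  shows "\<exists>s. \<forall>x t. x $ 1 = s \<longrightarrow> v (x, t) $ j = 0"
proof -
  obtain r r' where r: "\<nu> = r *\<^sub>R axis 1 1" "\<nu>' = r' *\<^sub>R axis 1 1"
    using par unfolding parallel_to_coord_plane_def by blast
  have r0: "r \<noteq> 0" "r' \<noteq> 0"
    using r fictitious_interface_bounded(4)[OF S(1) \<Omega>] fictitious_interface_bounded(4)[OF S(2) \<Omega>]
    by auto
  obtain d where d: "\<And>x t. \<nu> \<bullet> x = d \<Longrightarrow> cross3 \<nu> (v (x, t)) = 0"
    using fictitious_interface_poly_zero[OF S(1) \<Omega> ab poly_fun_linear[OF linear_cross3 v] tang] by blast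
  have "linear ((\<bullet>) \<nu>')" by (auto intro: linearI simp: inner_add_right)
  from fictitious_interface_poly_zero[OF S(2) \<Omega> ab poly_fun_linear[OF this v] norm]
  obtain d' where d': "\<And>x t. \<nu>' \<bullet> x = d' \<Longrightarrow> \<nu>' \<bullet> v (x, t) = 0" by blast
  have "v (x, t) $ 2 = 0 \<and> v (x, t) $ 3 = 0" if "x $ 1 = d / r" for x t
  proof -
    have "\<nu> \<bullet> x = d" using that r0 by (simp add: r inner_axis')
    from d[OF this, of t] show ?thesis
      using r0 by (auto simp: r cross3_def axis_def vec_eq_iff forall_3)
  qed
  moreover have "v (x, t) $ 1 = 0" if "x $ 1 = d' / r'" for x t
  proof -
    have "\<nu>' \<bullet> x = d'" using that r0 by (simp add: r inner_axis')
    from d'[OF this, of t] show ?thesis using r0 by (simp add: r inner_axis')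
  qed
  ultimately show ?thesis using exhaust_3[of j] by metis
qed

subsection \<open>Uniqueness for the evolution in the first coordinate direction\<close>

text \<open>A hyperplane with nonzero normal is nonempty, so each component of the constant is
  tested at some point.\<close>

lemma const_eq_0_if_hyperplane_components_0:
  fixes c :: "'b::euclidean_space" and e :: "'a::real_inner"
  assumes "e \<noteq> 0" and "\<forall>b\<in>Basis. \<exists>s. \<forall>z. z \<bullet> e = s \<longrightarrow> c \<bullet> b = 0"
  shows "c = 0"
proof (rule euclidean_eqI)
  fix b :: 'b assume "b \<in> Basis"
  then obtain s where s: "\<And>z. z \<bullet> e = s \<Longrightarrow> c \<bullet> b = 0" using assms(2) by blast
  have "((s / (e \<bullet> e)) *\<^sub>R e) \<bullet> e = s" using assms(1) by simp
  from s[OF this] show "c \<bullet> b = 0 \<bullet> b" by simp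
qed

lemma evolution_equation_dir_deriv:
  fixes u :: "'a::euclidean_space \<Rightarrow> 'b::euclidean_space"
  assumes "poly_fun k u" and "\<forall>z. dir_deriv e u z = (\<Sum>f\<in>F. A f (dir_deriv f u z))"
    and "\<forall>b\<in>Basis. \<exists>s. \<forall>z. z \<bullet> e = s \<longrightarrow> u z \<bullet> b = 0"
    and "\<And>f. f \<in> F \<Longrightarrow> f \<bullet> e = 0" and "\<And>f. f \<in> F \<Longrightarrow> linear (A f)" and "f \<in> F"
  shows "(\<forall>z. dir_deriv e (dir_deriv f u) z = (\<Sum>g\<in>F. A g (dir_deriv g (dir_deriv f u) z))) \<and>
    (\<forall>b\<in>Basis. \<exists>s. \<forall>z. z \<bullet> e = s \<longrightarrow> dir_deriv f u z \<bullet> b = 0)"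
proof (intro conjI allI ballI)
  show "dir_deriv e (dir_deriv f u) z = (\<Sum>g\<in>F. A g (dir_deriv g (dir_deriv f u) z))" for z
    by (rule dir_deriv_of_evolution_equation[OF assms(1,5) assms(2)[rule_format]])
  fix b :: 'b assume "b \<in> Basis"
  then obtain s where "\<forall>z. z \<bullet> e = s \<longrightarrow> u z \<bullet> b = 0" using assms(3) by blast
  from dir_deriv_inner_eq_0_on_hyperplane[OF assms(1) assms(4)[OF assms(6)] this[rule_format]]
  show "\<exists>s. \<forall>z. z \<bullet> e = s \<longrightarrow> dir_deriv f u z \<bullet> b = 0" by blast
qed

text \<open>Finite degree takes the place of an energy estimate: the coefficient maps are arbitrary
  linear maps, without any hyperbolicity.\<close>

lemma poly_fun_cauchy_zero:
  fixes u :: "'a::euclidean_space \<Rightarrow> 'b::euclidean_space"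
  assumes "span (insert e F) = UNIV" and "\<And>f. f \<in> F \<Longrightarrow> f \<bullet> e = 0" and "e \<noteq> 0"
    and "\<And>f. f \<in> F \<Longrightarrow> linear (A f)"
  shows "poly_fun k u \<Longrightarrow> \<forall>z. dir_deriv e u z = (\<Sum>f\<in>F. A f (dir_deriv f u z)) \<Longrightarrow>
    \<forall>b\<in>Basis. \<exists>s. \<forall>z. z \<bullet> e = s \<longrightarrow> u z \<bullet> b = 0 \<Longrightarrow> u z = 0"
proof (induction k arbitrary: u z)
  case 0
  obtain c where "u = (\<lambda>z. c)" using poly_fun_0D[OF "0.prems"(1)] .
  then show ?case
    using const_eq_0_if_hyperplane_components_0[OF \<open>e \<noteq> 0\<close>, of c] "0.prems"(3) by simp
next
  case (Suc k)
  have "poly_fun k (dir_deriv f u)" for f using poly_fun_dir_deriv[OF Suc.prems(1), of f] by simp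
  from Suc.IH[OF this] have w: "dir_deriv f u z = 0" if "f \<in> F" for f z
    using evolution_equation_dir_deriv[OF Suc.prems assms(2,4) that] by blast
  moreover have "dir_deriv e u z = 0" for z
    unfolding Suc.prems(2)[rule_format, of z] by (intro sum.neutral ballI) (simp add: w assms(4) linear_0)
  ultimately have "dir_deriv d u z = 0" if "d \<in> insert e F" for d z
    using that by blast
  from poly_fun_eq_const_if_dir_deriv_0[OF Suc.prems(1) assms(1) this]
  obtain c where c: "u = (\<lambda>z. c)" by blast
  then show ?case
    using const_eq_0_if_hyperplane_components_0[OF \<open>e \<noteq> 0\<close>, of c] Suc.prems(3) by simp
qed

text \<open>Components 2 and 3 of the two curl equations give the x_1-derivatives of components 3
  and 2 of both fields; the divergence equations give those of the first components. Together the
  six scalars satisfy one evolution equation in x_1.\<close>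

lemma maxwell_cauchy_zero:
  fixes H E :: vfield
  assumes H: "poly_fun k H" and E: "poly_fun k E"
    and \<mu>: "\<And>z. \<mu> *\<^sub>R time_deriv H z + curl E z = 0" and \<epsilon>: "\<And>z. \<epsilon> *\<^sub>R time_deriv E z - curl H z = 0"
    and div: "\<And>z. divergence H z = 0" "\<And>z. divergence E z = 0"
    and H0: "\<And>j. \<exists>s. \<forall>x t. x $ 1 = s \<longrightarrow> H (x, t) $ j = 0"
    and E0: "\<And>j. \<exists>s. \<forall>x t. x $ 1 = s \<longrightarrow> E (x, t) $ j = 0"
  shows "H z = 0 \<and> E z = 0"
proof -
  define a :: "3 \<Rightarrow> (real^3) \<times> real" where "a j = (axis j 1, 0)" for j
  define \<tau> :: "(real^3) \<times> real" where "\<tau> = (0, 1)"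
  define A :: "(real^3) \<times> real \<Rightarrow> (real^3) \<times> (real^3) \<Rightarrow> (real^3) \<times> (real^3)" where
    "A f = (\<lambda>(h, e). if f = a 2 then (vector [- h$2, h$1, 0], vector [- e$2, e$1, 0])
       else if f = a 3 then (vector [- h$3, 0, h$1], vector [- e$3, 0, e$1])
       else (vector [0, \<epsilon> * e$3, - \<epsilon> * e$2], vector [0, - \<mu> * h$3, \<mu> * h$2]))" for f
  \<comment> \<open>\<open>A\<close> collects the coefficients of the two curl equations and the two divergence equations
    after solving them for the derivative in direction \<open>a 1\<close>.\<close>
  define u where "u z = (H z, E z)" for z
  \<comment> \<open>\<open>A\<close> selects its coefficients by comparing directions, and the
    right-hand side is a sum over a set; both need the three tangential directions to be
    distinct.\<close>
  have neq: "a 2 \<noteq> a 3" "a 2 \<noteq> \<tau>" "a 3 \<noteq> \<tau>"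
    by (auto simp: a_def \<tau>_def axis_eq_axis)
  have "poly_fun k (\<lambda>z. (H z, 0) + (0, E z))"
    by (rule poly_fun.add) (rule poly_fun_linear[OF _ H] poly_fun_linear[OF _ E], auto intro: linearI)+
  then have pu: "poly_fun k u" by (simp add: u_def[abs_def])
  have du: "dir_deriv f u z = (dir_deriv f H z, dir_deriv f E z)" for f z
    unfolding u_def[abs_def]
    by (rule dir_deriv_eqI)
       (intro has_derivative_Pair poly_fun_has_derivative[OF H] poly_fun_has_derivative[OF E])
  have Aeq: "A (a 2) (h, e) = (vector [- h$2, h$1, 0], vector [- e$2, e$1, 0])"
      "A (a 3) (h, e) = (vector [- h$3, 0, h$1], vector [- e$3, 0, e$1])"
      "A \<tau> (h, e) = (vector [0, \<epsilon> * e$3, - \<epsilon> * e$2], vector [0, - \<mu> * h$3, \<mu> * h$2])" for h e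
    using neq by (simp_all add: A_def)
  have sumF: "(\<Sum>f\<in>{a 2, a 3, \<tau>}. g f) = g (a 2) + g (a 3) + g \<tau>"
    for g :: "_ \<Rightarrow> (real^3) \<times> (real^3)"
    using neq by (simp add: add.assoc)
  have "u z = 0"
  proof (rule poly_fun_cauchy_zero[OF _ _ _ _ pu, of "a 1" "{a 2, a 3, \<tau>}" A])
    have "w \<in> span (insert (a 1) {a 2, a 3, \<tau>})" for w
    proof -
      have "w = (fst w $ 1) *\<^sub>R a 1 + (fst w $ 2) *\<^sub>R a 2 + (fst w $ 3) *\<^sub>R a 3 + snd w *\<^sub>R \<tau>"
        by (auto simp: prod_eq_iff a_def \<tau>_def vec_eq_iff forall_3 axis_def)
      also have "\<dots> \<in> span (insert (a 1) {a 2, a 3, \<tau>})"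
        by (intro span_add span_scale span_base) auto
      finally show ?thesis .
    qed
    then show "span (insert (a 1) {a 2, a 3, \<tau>}) = UNIV" by blast
    show "f \<bullet> a 1 = 0" if "f \<in> {a 2, a 3, \<tau>}" for f
      using that by (auto simp: a_def \<tau>_def inner_axis_axis)
    show "a 1 \<noteq> 0" by (auto simp: a_def zero_prod_def)
    show "linear (A f)" for f
      by (auto intro!: linearI simp: A_def vec_eq_iff forall_3 algebra_simps)
    have "dir_deriv (a 1) u z = (\<Sum>f\<in>{a 2, a 3, \<tau>}. A f (dir_deriv f u z))" for z
      using \<mu>[of z] \<epsilon>[of z] div[of z]
      unfolding time_deriv_eq_dir_deriv[OF H] time_deriv_eq_dir_deriv[OF E]
        curl_eq_dir_deriv[OF H] curl_eq_dir_deriv[OF E]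
        divergence_eq_dir_deriv[OF H] divergence_eq_dir_deriv[OF E]
        a_def[symmetric] \<tau>_def[symmetric] sumF Aeq du
      by (simp add: prod_eq_iff vec_eq_iff forall_3 sum_3 cross3_def axis_def algebra_simps)
    then show "\<forall>z. dir_deriv (a 1) u z = (\<Sum>f\<in>{a 2, a 3, \<tau>}. A f (dir_deriv f u z))" ..
    have "\<exists>s. \<forall>z. z \<bullet> a 1 = s \<longrightarrow> u z \<bullet> b = 0" if "b \<in> Basis" for b
    proof -
      have "(\<exists>j. b = (axis j 1, 0)) \<or> (\<exists>j. b = (0, axis j 1))"
        using that by (auto simp: Basis_prod_def Basis_vec_def)
      then show ?thesis
        using H0 E0 by (auto simp: u_def a_def inner_axis)
    qed
    then show "\<forall>b\<in>Basis. \<exists>s. \<forall>z. z \<bullet> a 1 = s \<longrightarrow> u z \<bullet> b = 0" ..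
  qed
  then show ?thesis by (simp add: u_def zero_prod_def)
qed

subsection \<open>The minimization problem\<close>

theorem proposition3p2:
  fixes \<mu> \<epsilon> l \<Delta>t t\<^sub>n c\<^sub>p :: real and k :: nat
    and p :: "real^3" and \<Omega> \<Omega>m \<Omega>p \<Gamma> :: "(real^3) set" and I :: "real set"
    and n :: "real^3 \<Rightarrow> real^3"
    and N :: "nat \<Rightarrow> nat" and \<Gamma>f :: "nat \<Rightarrow> nat \<Rightarrow> (real^3) set" and nf :: "nat \<Rightarrow> nat \<Rightarrow> real^3"
    and Es Hs :: vfield and V W :: "vfield set"
  assumes "\<mu> > 0" and "\<epsilon> > 0" and "l > 0" and "\<Delta>t > 0" and "c\<^sub>p > 0"
    and "embedded_boundary \<Omega>m \<Omega>p \<Gamma> n"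
    and "p \<in> \<Gamma>" and "\<Omega> = local_patch p l" and "I = {t\<^sub>n - \<Delta>t..t\<^sub>n}"
    and "\<And>m i. m \<in> {1..4} \<Longrightarrow> i \<in> {1..N m} \<Longrightarrow> fictitious_interface \<Omega>p \<Omega> (\<Gamma>f m i) (nf m i)"
    and "\<And>m i. m \<in> {1, 3} \<Longrightarrow> i \<in> {1..N m} \<Longrightarrow> square_integrable_field (\<Gamma>f m i) I Es"
    and "\<And>m i. m \<in> {2, 4} \<Longrightarrow> i \<in> {1..N m} \<Longrightarrow> square_integrable_field (\<Gamma>f m i) I Hs"
    and "V = div_free_poly k \<Omega> I" and "W = V"
    and "\<And>m (j::3). m \<in> {1..4} \<Longrightarrow>
           (\<exists>i\<in>{1..N m}. parallel_to_coord_plane (nf m i) j) \<and>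
           (\<exists>i\<in>{1..N m}. orthogonal_to_coord_plane (nf m i) j)"
  shows "\<exists>c c\<^sub>f. c > 0 \<and> c\<^sub>f > 0 \<and> c = c\<^sub>f / l \<and>
           (\<exists>!D. D \<in> V \<times> W \<and>
              (\<forall>D'\<in>V \<times> W. Jtilde \<mu> \<epsilon> l c\<^sub>p c\<^sub>f \<Omega> I \<Gamma> n N \<Gamma>f nf Es Hs D
                                \<le> Jtilde \<mu> \<epsilon> l c\<^sub>p c\<^sub>f \<Omega> I \<Gamma> n N \<Gamma>f nf Es Hs D'))"
proof -
  define a b where "a = t\<^sub>n - \<Delta>t" and "b = t\<^sub>n"
  have ab: "a < b" and I: "I = {a..b}" using assms(4,9) by (simp_all add: a_def b_def)
  note l = assms(3) and \<Omega> = assms(8) and \<Gamma> = assms(6)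
  have cpt: "compact \<Omega>" and bdd: "bounded \<Omega>" using \<Omega> by (simp_all add: local_patch_def)
  define U where "U = V \<times> V"
  have Ueq: "V \<times> W = U" "U = div_free_poly k \<Omega> I \<times> div_free_poly k \<Omega> I"
    using assms(13,14) by (simp_all add: U_def)
  have subspace: "module.subspace pair_scale U"
    unfolding Ueq by (rule subspace_div_free_poly)
  have m: "module pair_scale" using vector_space_pair_scale by (simp add: module_iff_vector_space)
  have U: "\<And>x y. x \<in> U \<Longrightarrow> y \<in> U \<Longrightarrow> x + y \<in> U" "\<And>r x. x \<in> U \<Longrightarrow> pair_scale r x \<in> U"
    using module.subspace_add[OF m subspace] module.subspace_scale[OF m subspace] by blast+
  have p: "poly_fun k (fst D)" "poly_fun k (snd D)" if "D \<in> U" for D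
    using that by (auto simp: Ueq intro: poly_fun_if_div_free_poly)
  have scale: "fst (pair_scale r D) = (\<lambda>z. r *\<^sub>R fst D z)" "snd (pair_scale r D) = (\<lambda>z. r *\<^sub>R snd D z)" for r D
    by (simp_all add: pair_scale_def)
  have lin: "bounded_linear (cross3 \<nu>)" "bounded_linear ((\<bullet>) \<nu>)" for \<nu> :: "real^3"
    by (rule bounded_linear_cross3 bounded_linear_inner_right)+
  have fic: "fictitious_interface \<Omega>p \<Omega> (\<Gamma>f m i) (nf m i)" if "m \<in> {1..4}" "i \<in> {1..N m}" for m i
    using assms(10) that .

  define F1 :: "vfield \<times> vfield \<Rightarrow> vfield" where
    "F1 D = (\<lambda>z. \<mu> *\<^sub>R time_deriv (fst D) z + curl (snd D) z)" for D
  define F2 :: "vfield \<times> vfield \<Rightarrow> vfield" where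
    "F2 D = (\<lambda>z. \<epsilon> *\<^sub>R time_deriv (snd D) z - curl (fst D) z)" for D
  define F3 :: "vfield \<times> vfield \<Rightarrow> vfield" where
    "F3 D = (\<lambda>(x, t). cross3 (n x) (snd D (x, t)))" for D
  define F4 :: "vfield \<times> vfield \<Rightarrow> (real^3) \<times> real \<Rightarrow> real" where
    "F4 D = (\<lambda>(x, t). n x \<bullet> fst D (x, t))" for D
  define Q1 where "Q1 D = patch_sq \<Omega> I (F1 D)" for D
  define Q2 where "Q2 D = patch_sq \<Omega> I (F2 D)" for D
  define Q3 where "Q3 D = surface_sq \<Omega> I \<Gamma> (F3 D)" for D
  define Q4 where "Q4 D = surface_sq \<Omega> I \<Gamma> (F4 D)" for D
  define Q5 where
    "Q5 i D = surface_sq \<Omega> I (\<Gamma>f 1 i) (\<lambda>z. cross3 (nf 1 i) (snd D z))" for i and D :: "vfield \<times> vfield"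
  define Q6 where
    "Q6 i D = surface_sq \<Omega> I (\<Gamma>f 2 i) (\<lambda>z. cross3 (nf 2 i) (fst D z))" for i and D :: "vfield \<times> vfield"
  define Q7 where
    "Q7 i D = surface_sq \<Omega> I (\<Gamma>f 3 i) (\<lambda>z. nf 3 i \<bullet> snd D z)" for i and D :: "vfield \<times> vfield"
  define Q8 where
    "Q8 i D = surface_sq \<Omega> I (\<Gamma>f 4 i) (\<lambda>z. nf 4 i \<bullet> fst D z)" for i and D :: "vfield \<times> vfield"

  have pF: "poly_fun k (F1 D)" "poly_fun k (F2 D)" if "D \<in> U" for D
  proof -
    have s: "linear (\<lambda>y :: real^3. c *\<^sub>R y)" for c by (auto intro: linearI simp: scaleR_add_right)
    show "poly_fun k (F1 D)" unfolding F1_def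
      by (intro poly_fun.add poly_fun_linear[OF s] poly_fun_time_deriv poly_fun_curl p that)
    have "poly_fun k (\<lambda>z. \<epsilon> *\<^sub>R time_deriv (snd D) z + (-1) *\<^sub>R curl (fst D) z)"
      by (intro poly_fun.add poly_fun_linear[OF s] poly_fun_time_deriv poly_fun_curl p that)
    then show "poly_fun k (F2 D)" by (simp add: F2_def)
  qed

  \<comment> \<open>Volume terms carry no data, so the general result is used with \<open>g\<close>
    equal to 0 and the form is its own homogeneous part. The boundary terms below are treated in the
    same way.\<close>
  have "quadratic_on pair_scale U Q1 Q1 \<and> quadratic_on pair_scale U Q2 Q2"
  proof -
    have dom: "spacetime_domain lborel \<Omega> a b" unfolding \<Omega> by (rule patch_domain[OF l ab])
    note L2_continuous = spacetime_domain.L2_field_continuous[OF dom]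
      and quadratic = spacetime_domain.quadratic_on_st_inner[OF dom]
    have L2: "L2_field lborel \<Omega> {a..b} (F1 D)" "L2_field lborel \<Omega> {a..b} (F2 D)" if "D \<in> U" for D
      using pF[OF that] bdd by (auto intro: L2_continuous poly_fun_continuous)
    have 0: "L2_field lborel \<Omega> {a..b} (\<lambda>z. 0 :: real^3)"
      using bdd by (intro L2_continuous) auto
    have "F1 (x + y) z = F1 x z + F1 y z" "F2 (x + y) z = F2 x z + F2 y z" if "x \<in> U" "y \<in> U" for x y z
      using p[OF that(1)] p[OF that(2)]
      by (simp_all add: F1_def F2_def time_deriv_add curl_add algebra_simps)
    moreover have "F1 (pair_scale r x) z = r *\<^sub>R F1 x z" "F2 (pair_scale r x) z = r *\<^sub>R F2 x z"
      if "x \<in> U" for r x z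
      using p[OF that]
      by (simp_all add: F1_def F2_def scale time_deriv_scaleR curl_scaleR algebra_simps)
    ultimately show ?thesis
      using quadratic[of U pair_scale F1 "\<lambda>z. 0"] quadratic[of U pair_scale F2 "\<lambda>z. 0"] U L2 0
      by (simp add: Q1_def[abs_def] Q2_def[abs_def] patch_sq_def I)
  qed
  then have q12: "quadratic_on pair_scale U Q1 Q1" "quadratic_on pair_scale U Q2 Q2" by auto

  have "quadratic_on pair_scale U Q3 Q3 \<and> quadratic_on pair_scale U Q4 Q4"
  proof -
    note dom = embedded_boundary_domain[OF \<Gamma> cpt ab]
    note L2_continuous = spacetime_domain.L2_field_continuous[OF dom]
      and quadratic = spacetime_domain.quadratic_on_st_inner[OF dom]
    have "continuous_on UNIV (\<lambda>(x, y). cross3 x y)" "continuous_on UNIV (\<lambda>(x :: real^3, y). x \<bullet> y)"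
      by (auto simp: case_prod_beta intro!: continuous_intros continuous_on_cross)
    then have L2: "L2_field surface_measure (\<Omega> \<inter> \<Gamma>) {a..b} (F3 D)"
        "L2_field surface_measure (\<Omega> \<inter> \<Gamma>) {a..b} (F4 D)" if "D \<in> U" for D
      unfolding F3_def F4_def using p[OF that]
      by (auto intro!: L2_field_normal[OF \<Gamma> cpt ab] norm_cross3_le Cauchy_Schwarz_ineq2)
    have 0: "L2_field surface_measure (\<Omega> \<inter> \<Gamma>) {a..b} (\<lambda>z. 0 :: real^3)"
        "L2_field surface_measure (\<Omega> \<inter> \<Gamma>) {a..b} (\<lambda>z. 0 :: real)"
      using bdd by (auto intro!: L2_continuous)
    have "F3 (x + y) z = F3 x z + F3 y z" "F4 (x + y) z = F4 x z + F4 y z" for x y z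
      by (simp_all add: F3_def F4_def case_prod_beta cross_add_right inner_add_right)
    moreover have "F3 (pair_scale r x) z = r *\<^sub>R F3 x z" "F4 (pair_scale r x) z = r *\<^sub>R F4 x z" for r x z
      by (simp_all add: F3_def F4_def scale case_prod_beta cross_mult_right)
    ultimately show ?thesis
      using quadratic[of U pair_scale F3 "\<lambda>z. 0"] quadratic[of U pair_scale F4 "\<lambda>z. 0"] U L2 0
      by (simp add: Q3_def[abs_def] Q4_def[abs_def] surface_sq_def I)
  qed
  then have q34: "quadratic_on pair_scale U Q3 Q3" "quadratic_on pair_scale U Q4 Q4" by auto

  have q5: "quadratic_on pair_scale U (Q5 i) (\<lambda>D. surface_sq \<Omega> I (\<Gamma>f 1 i) (\<lambda>z. cross3 (nf 1 i) (snd D z - Es z)))"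
    if "i \<in> {1..N 1}" for i
    unfolding Q5_def[abs_def] I
    by (rule quadratic_on_interface[OF fic bdd ab lin(1), where F = snd])
       (use assms(11)[of 1 i] that U p in \<open>auto simp: scale I\<close>)
  have q6: "quadratic_on pair_scale U (Q6 i) (\<lambda>D. surface_sq \<Omega> I (\<Gamma>f 2 i) (\<lambda>z. cross3 (nf 2 i) (fst D z - Hs z)))"
    if "i \<in> {1..N 2}" for i
    unfolding Q6_def[abs_def] I
    by (rule quadratic_on_interface[OF fic bdd ab lin(1), where F = fst])
       (use assms(12)[of 2 i] that U p in \<open>auto simp: scale I\<close>)
  have q7: "quadratic_on pair_scale U (Q7 i) (\<lambda>D. surface_sq \<Omega> I (\<Gamma>f 3 i) (\<lambda>z. nf 3 i \<bullet> (snd D z - Es z)))"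
    if "i \<in> {1..N 3}" for i
    unfolding Q7_def[abs_def] I
    by (rule quadratic_on_interface[OF fic bdd ab lin(2), where F = snd])
       (use assms(11)[of 3 i] that U p in \<open>auto simp: scale I\<close>)
  have q8: "quadratic_on pair_scale U (Q8 i) (\<lambda>D. surface_sq \<Omega> I (\<Gamma>f 4 i) (\<lambda>z. nf 4 i \<bullet> (fst D z - Hs z)))"
    if "i \<in> {1..N 4}" for i
    unfolding Q8_def[abs_def] I
    by (rule quadratic_on_interface[OF fic bdd ab lin(2), where F = fst])
       (use assms(12)[of 4 i] that U p in \<open>auto simp: scale I\<close>)

  \<comment> \<open>The interface weights for the choice in which the fictitious-interface constant
    equals \<open>l\<close>.\<close>
  define wE wH where "wE = l / (2 * real (N 1 + N 3))" and "wH = l / (2 * real (N 2 + N 4))"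
  \<comment> \<open>The functional with both data fields replaced by 0.\<close>
  define Q where "Q D = l / 2 * Q1 D + l / 2 * Q2 D + c\<^sub>p / 2 * Q3 D + c\<^sub>p / 2 * Q4 D
      + wE * (\<Sum>i=1..N 1. Q5 i D) + wH * (\<Sum>i=1..N 2. Q6 i D)
      + wE * (\<Sum>i=1..N 3. Q7 i D) + wH * (\<Sum>i=1..N 4. Q8 i D)" for D
  let ?J = "Jtilde \<mu> \<epsilon> l c\<^sub>p l \<Omega> I \<Gamma> n N \<Gamma>f nf Es Hs"
  have J: "quadratic_on pair_scale U Q ?J"
  proof -
    have "?J = (\<lambda>D. l / 2 * Q1 D + l / 2 * Q2 D + c\<^sub>p / 2 * Q3 D + c\<^sub>p / 2 * Q4 D
      + wE * (\<Sum>i=1..N 1. surface_sq \<Omega> I (\<Gamma>f 1 i) (\<lambda>z. cross3 (nf 1 i) (snd D z - Es z)))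
      + wH * (\<Sum>i=1..N 2. surface_sq \<Omega> I (\<Gamma>f 2 i) (\<lambda>z. cross3 (nf 2 i) (fst D z - Hs z)))
      + wE * (\<Sum>i=1..N 3. surface_sq \<Omega> I (\<Gamma>f 3 i) (\<lambda>z. nf 3 i \<bullet> (snd D z - Es z)))
      + wH * (\<Sum>i=1..N 4. surface_sq \<Omega> I (\<Gamma>f 4 i) (\<lambda>z. nf 4 i \<bullet> (fst D z - Hs z))))"
      unfolding Jtilde_def Q1_def Q2_def Q3_def Q4_def F1_def F2_def F3_def F4_def wE_def wH_def
      by (simp add: case_prod_beta')
    then show ?thesis
      unfolding Q_def[abs_def]
      by (simp only:) (intro quadratic_on_add quadratic_on_mult quadratic_on_sum q12 q34 q5 q6 q7 q8)
  qed

  have pos: "Q D > 0" if D: "D \<in> U" "D \<noteq> 0" for D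
  proof (rule ccontr)
    assume "\<not> Q D > 0"
    have nn: "patch_sq \<Omega> I v \<ge> 0" "surface_sq \<Omega> I S w \<ge> 0"
      for v :: vfield and w :: "(real^3) \<times> real \<Rightarrow> 'b::real_inner" and S
      unfolding patch_sq_def surface_sq_def st_inner_def set_lebesgue_integral_def
      by (intro Bochner_Integration.integral_nonneg scaleR_nonneg_nonneg; auto)+
    have i: "\<exists>i\<in>{1..N m}. parallel_to_coord_plane (nf m i) 1" if "m \<in> {1..4}" for m
      using assms(15) that by blast
    obtain i1 i2 i3 i4 where i: "i1 \<in> {1..N 1}" "i2 \<in> {1..N 2}" "i3 \<in> {1..N 3}" "i4 \<in> {1..N 4}"
      and par: "parallel_to_coord_plane (nf 1 i1) 1" "parallel_to_coord_plane (nf 2 i2) 1"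
        "parallel_to_coord_plane (nf 3 i3) 1" "parallel_to_coord_plane (nf 4 i4) 1"
      using i[of 1] i[of 2] i[of 3] i[of 4] by auto
    \<comment> \<open>The interfaces just obtained show that the counts in the denominators are
      nonzero; with a zero count, division would give weight 0.\<close>
    have w: "wE > 0" "wH > 0" using l i by (auto simp: wE_def wH_def)
    have s5: "(\<Sum>i=1..N 1. Q5 i D) \<ge> 0" unfolding Q5_def by (intro sum_nonneg nn)
    have s6: "(\<Sum>i=1..N 2. Q6 i D) \<ge> 0" unfolding Q6_def by (intro sum_nonneg nn)
    have s7: "(\<Sum>i=1..N 3. Q7 i D) \<ge> 0" unfolding Q7_def by (intro sum_nonneg nn)
    have s8: "(\<Sum>i=1..N 4. Q8 i D) \<ge> 0" unfolding Q8_def by (intro sum_nonneg nn)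
    have "0 \<le> l / 2 * Q1 D" "0 \<le> l / 2 * Q2 D" "0 \<le> c\<^sub>p / 2 * Q3 D" "0 \<le> c\<^sub>p / 2 * Q4 D"
      using l assms(5) by (simp_all add: Q1_def Q2_def Q3_def Q4_def nn)
    moreover have "0 \<le> wE * (\<Sum>i=1..N 1. Q5 i D)" "0 \<le> wH * (\<Sum>i=1..N 2. Q6 i D)"
        "0 \<le> wE * (\<Sum>i=1..N 3. Q7 i D)" "0 \<le> wH * (\<Sum>i=1..N 4. Q8 i D)"
      using w s5 s6 s7 s8 by simp_all
    \<comment> \<open>Eight nonnegative terms have a sum that is not positive, so each is zero; then
      each nonnegative summand of an interface sum is zero, in particular the one for the chosen
      interface.\<close>
    ultimately have "l / 2 * Q1 D = 0" "l / 2 * Q2 D = 0"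
        "wE * (\<Sum>i=1..N 1. Q5 i D) = 0" "wH * (\<Sum>i=1..N 2. Q6 i D) = 0"
        "wE * (\<Sum>i=1..N 3. Q7 i D) = 0" "wH * (\<Sum>i=1..N 4. Q8 i D) = 0"
      using \<open>\<not> Q D > 0\<close> unfolding Q_def by linarith+
    then have z: "Q1 D = 0" "Q2 D = 0" "(\<Sum>i=1..N 1. Q5 i D) = 0" "(\<Sum>i=1..N 2. Q6 i D) = 0"
        "(\<Sum>i=1..N 3. Q7 i D) = 0" "(\<Sum>i=1..N 4. Q8 i D) = 0"
      using l w by simp_all
    have z5: "Q5 i1 D = 0" using z(3) i(1) by (subst (asm) sum_nonneg_eq_0_iff) (auto simp: Q5_def nn)
    have z6: "Q6 i2 D = 0" using z(4) i(2) by (subst (asm) sum_nonneg_eq_0_iff) (auto simp: Q6_def nn)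
    have z7: "Q7 i3 D = 0" using z(5) i(3) by (subst (asm) sum_nonneg_eq_0_iff) (auto simp: Q7_def nn)
    have z8: "Q8 i4 D = 0" using z(6) i(4) by (subst (asm) sum_nonneg_eq_0_iff) (auto simp: Q8_def nn)
    have E0: "\<exists>s. \<forall>x t. x $ 1 = s \<longrightarrow> snd D (x, t) $ j = 0" for j
      using interfaces_zero_on_planes[OF fic fic par(1,3) bdd ab p(2)[OF D(1)]] z5 z7 i
      by (simp add: Q5_def Q7_def I)
    have H0: "\<exists>s. \<forall>x t. x $ 1 = s \<longrightarrow> fst D (x, t) $ j = 0" for j
      using interfaces_zero_on_planes[OF fic fic par(2,4) bdd ab p(1)[OF D(1)]] z6 z8 i
      by (simp add: Q6_def Q8_def I)
    have "F1 D z = 0" "F2 D z = 0" for z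
      using patch_poly_zero[OF l ab pF(1)[OF D(1)]] patch_poly_zero[OF l ab pF(2)[OF D(1)]] z(1,2)
      by (simp_all add: Q1_def Q2_def I \<Omega>)
    then have pde: "\<mu> *\<^sub>R time_deriv (fst D) z + curl (snd D) z = 0"
        "\<epsilon> *\<^sub>R time_deriv (snd D) z - curl (fst D) z = 0" for z
      by (simp_all add: F1_def F2_def)
    have div: "divergence (fst D) z = 0" "divergence (snd D) z = 0" for z
      by (rule div_free_poly_divergence[OF _ l ab], use D(1) in \<open>auto simp: Ueq \<Omega> I\<close>)+
    have "fst D z = 0 \<and> snd D z = 0" for z
      by (rule maxwell_cauchy_zero[OF p[OF D(1)] pde div H0 E0])
    then have "D = 0" by (auto simp: prod_eq_iff fun_eq_iff)
    then show False using D by simp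
  qed

  obtain t where "finite t" "U \<subseteq> module.span pair_scale t"
    using div_free_poly_finite_dim[of k \<Omega> I] unfolding Ueq by blast
  from quadratic_on_unique_minimizer[OF vector_space_pair_scale this(1) subspace this(2) J pos]
  have "\<exists>!D. D \<in> V \<times> W \<and> (\<forall>D'\<in>V \<times> W. ?J D \<le> ?J D')" unfolding Ueq(1) .
  then show ?thesis
    using l by (intro exI[of _ 1] exI[of _ l]) simp
qed

end
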